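(* There exists a (large) universal constant $K>0$ such that the following holds. Let $b>0$, let $0<b_i\leq b$ for $i=1,\ldots,n$, and let $X_{1},\ldots,X_{n}$ be independent random variables with $\mathbb{E}(X_{i})=0$ and $|X_{i}|\leq b_{i}$ for $i=1,\ldots,n$. Let $S_{n}=\sum_{i=1}^{n}X_{i}$, let $\sigma\ge 0$ with $\sigma^{2}=\mathbb{E}\left[\left(\sum_{i=1}^{n}X_{i}\right)^{2}\right]$, and let $p\geq 1$ be an integer. Put $\mu_{i}^{k}=\mathbb{E}\left[(X_{i}+b_{i})^{k}\right]$ and $D_{n}=\sum_{j=1}^{n}\left(\mu_{j}^{2}/\mu_{j}^{1}\right)^{2}$. Then for all $0<t\leq\sigma^{2}/(Kb)$, $$\mathbb{P}(S_{n}\geq t)\leq\exp\left(-\frac{t^{2}}{2\sum_{i=1}^{n}b_{i}^{2}\,C_{p}\left(8tb_{i}/D_{n},2b_{i},\mu_{i}^{1},\ldots,\mu_{i}^{p}\right)}\right)\left(\theta\left(\frac{t}{\sigma}\right)+\frac{Kb}{\sigma}\right).$$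
   Context: The superscript $k$ in $\mu_i^k$ is an index (order of the moment), not a power. The function $\theta$ is $$\theta(x)=\frac{1}{(2\pi)^{1/2}}\exp(x^{2}/2)\int_{x}^{\infty}\exp(-u^{2}/2)\,du .$$ For $y>0$, $\beta>0$ and numbers $\mu^1,\ldots,\mu^p$ (superscripts being indices), $$C_{p}(y,\beta,\mu^{1},\ldots,\mu^{p})=\left(\frac{\mu^{p}\exp(y)+\sum_{j=0}^{p-3}\frac{y^{j}}{j!}\left(\beta^{p-j-2}\mu^{j+2}-\mu^{p}\right)}{\mu^{p}\exp(y)+\sum_{j=0}^{p-2}\frac{y^{j}}{j!}\left(\beta^{p-j-1}\mu^{j+1}-\mu^{p}\right)}\right)^{2},$$ where a sum $\sum_{j=0}^{m}$ with $m<0$ is $0$. *)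

theory Defs
  imports "HOL-Probability.Probability"
begin

definition \<theta> :: "real \<Rightarrow> real" where
  "\<theta> x = 1 / sqrt (2 * pi) * exp (x\<^sup>2 / 2) * (LBINT u:{x..}. exp (- u\<^sup>2 / 2))"

text \<open>
  The superscripts of \<open>\<mu>\<close> are indices, so \<open>\<mu> k\<close> is the \<open>k\<close>-th moment; only the values at
  \<open>k = 1, \<dots>, p\<close> matter (for \<open>p \<ge> 1\<close>). The sums over \<open>0 \<le> j \<le> p - 3\<close> and \<open>0 \<le> j \<le> p - 2\<close> are
  written as \<open>j < p - 2\<close> and \<open>j < p - 1\<close>: with truncated subtraction these are empty
  for \<open>p \<le> 2\<close> and for \<open>p \<le> 1\<close> respectively, and no exponent is truncated inside the sums.
\<close>

definition C :: "nat \<Rightarrow> real \<Rightarrow> real \<Rightarrow> (nat \<Rightarrow> real) \<Rightarrow> real" where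
  "C p y \<beta> \<mu> =
     ((\<mu> p * exp y + (\<Sum>j<p - 2. y ^ j / fact j * (\<beta> ^ (p - j - 2) * \<mu> (j + 2) - \<mu> p))) /
      (\<mu> p * exp y + (\<Sum>j<p - 1. y ^ j / fact j * (\<beta> ^ (p - j - 1) * \<mu> (j + 1) - \<mu> p))))\<^sup>2"

text \<open>
  \<open>tail_bound_const TYPE('a) K\<close>: the constant \<open>K\<close> works for all independent families on all
  probability spaces whose sample space has type \<open>'a\<close>. The bound \<open>\<bar>X\<^sub>i\<bar> \<le> b\<^sub>i\<close> is required almost
  surely. Measurability of the \<open>X\<^sub>i\<close> is part of \<^const>\<open>prob_space.indep_vars\<close>.

  HOL cannot quantify over types inside a formula, so \<open>\<exists>K>0. tail_bound_const TYPE('a) K\<close> would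
  formally let \<open>K\<close> depend on \<open>'a\<close>. A universal constant is expressed by producing \<open>K\<close> for one
  fixed type and stating, polymorphically in \<open>'a\<close>, that every such \<open>K\<close> also works for \<open>'a\<close>.
\<close>

definition tail_bound_const :: "'a itself \<Rightarrow> real \<Rightarrow> bool" where
  "tail_bound_const (_ :: 'a itself) K \<longleftrightarrow>
    (\<forall>(M :: 'a measure) (n :: nat) (X :: nat \<Rightarrow> 'a \<Rightarrow> real) (b :: real) (bs :: nat \<Rightarrow> real)
       (\<sigma> :: real) (p :: nat) (t :: real).
      prob_space M \<longrightarrow>
      b > 0 \<longrightarrow>
      (\<forall>i\<in>{1..n}. 0 < bs i \<and> bs i \<le> b) \<longrightarrow>
      prob_space.indep_vars M (\<lambda>_. borel) X {1..n} \<longrightarrow>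
      (\<forall>i\<in>{1..n}. prob_space.expectation M (X i) = 0) \<longrightarrow>
      (\<forall>i\<in>{1..n}. AE \<omega> in M. \<bar>X i \<omega>\<bar> \<le> bs i) \<longrightarrow>
      \<sigma> \<ge> 0 \<longrightarrow>
      \<sigma>\<^sup>2 = prob_space.expectation M (\<lambda>\<omega>. (\<Sum>i=1..n. X i \<omega>)\<^sup>2) \<longrightarrow>
      p \<ge> 1 \<longrightarrow>
      0 < t \<longrightarrow> t \<le> \<sigma>\<^sup>2 / (K * b) \<longrightarrow>
      (let S = (\<lambda>\<omega>. \<Sum>i=1..n. X i \<omega>);
           \<mu> = (\<lambda>i k. prob_space.expectation M (\<lambda>\<omega>. (X i \<omega> + bs i) ^ k));
           D = (\<Sum>j=1..n. (\<mu> j 2 / \<mu> j 1)\<^sup>2)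
       in prob_space.prob M {\<omega> \<in> space M. S \<omega> \<ge> t}
          \<le> exp (- (t\<^sup>2 / (2 * (\<Sum>i=1..n. (bs i)\<^sup>2 * C p (8 * t * bs i / D) (2 * bs i) (\<mu> i)))))
             * (\<theta> (t / \<sigma>) + K * b / \<sigma>)))"

end

theory Submission
  imports Defs
begin

text \<open>
  The tail is reduced by exponential tilting to a Laplace transform of a nearly Gaussian variable.
  Let \<open>\<psi> u = (\<Sum>i. ln (E (exp (u * X\<^sub>i))))\<close> and choose \<open>l\<close> with \<open>\<psi>' l = t\<close>. Under the probability \<open>Q\<close> with
  density \<open>exp (l * S - \<psi> l)\<close> the sum \<open>S\<close> has mean \<open>t\<close> and variance \<open>s\<^sup>2 = \<psi>'' l\<close>, and
  \<open>P (S \<ge> t) = exp (\<psi> l - l * t) * E\<^sub>Q (exp (- l * (S - t)); S \<ge> t)\<close>.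

  The prefactor \<open>\<theta> (t / \<sigma>) + K * b / \<sigma>\<close> comes from the expectation under \<open>Q\<close>. There \<open>W = (S - t) / s\<close>
  is a standardised sum of independent summands of size at most \<open>a = 2 * b / s\<close>, so Stein's method
  bounds \<open>Q (0 \<le> W \<le> x)\<close> by the Gaussian probability plus a multiple of \<open>a\<close>
  (lemma \<open>interval_bound\<close>). Averaging over \<open>x\<close> with exponential weights turns this into a bound for
  \<open>E\<^sub>Q (exp (- l * s * W); W \<ge> 0)\<close> (lemma \<open>laplace_bound\<close>), and for a Gaussian variable that
  expectation is exactly \<open>\<theta> (l * s)\<close>. Because \<open>\<psi>'' u\<close> lies between \<open>\<sigma>\<^sup>2 * exp (- 2 * u * b)\<close> and
  \<open>\<sigma>\<^sup>2 * exp (2 * u * b)\<close>, the number \<open>l * s\<close> is at least \<open>t / \<sigma>\<close> up to a factor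
  \<open>1 - O (t * b / \<sigma>\<^sup>2)\<close>, which costs another \<open>O (b / \<sigma>)\<close> (lemma \<open>theta_scaling\<close>).

  The exponent comes from \<open>exp (\<psi> l - l * t)\<close>. By convexity \<open>l\<close> minimises \<open>\<psi> u - u * t\<close>, so any \<open>u\<close> may
  be used instead, and \<open>u = t / V\<close> gives \<open>- t\<^sup>2 / (2 * V)\<close> once \<open>\<psi>'' \<le> V\<close> on \<open>[0, u]\<close>. The variance of
  \<open>Y = X\<^sub>i + b\<^sub>i\<close> under the tilt is \<open>A - B\<^sup>2\<close> with \<open>A\<close> and \<open>B\<close> the tilted expectations of \<open>Y\<^sup>2\<close> and \<open>Y\<close>,
  and \<open>A - B\<^sup>2 \<le> (A / B)\<^sup>2 / 4\<close>. The quotient \<open>A / B\<close> is the logarithmic derivative of the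
  exponential generating function of the moments of \<open>Y\<close> from the first on. It grows if every moment
  beyond the \<open>p\<close>-th is replaced by its upper bound in terms of the \<open>p\<close>-th one, and the result
  is the expression that defines \<open>C\<close> (lemmas \<open>log_deriv_le_truncated\<close>, \<open>tilted_var_le_C\<close>).
  Finally \<open>C\<close> is increasing in its argument and \<open>4 * b\<^sub>i\<^sup>2 * C\<close> is at least the square of the quotient
  of the first two moments. Hence the denominator \<open>V\<close> is at least \<open>D / 4\<close>, so that \<open>u \<le> 4 * t / D\<close>
  and \<open>2 * b\<^sub>i * u\<close> stays below the argument \<open>8 * t * b\<^sub>i / D\<close> (lemma \<open>exponent_bound\<close>).
\<close>


section \<open>The Gaussian tail function\<close>

lemma integrable_normal_mult:
  fixes g :: "real \<Rightarrow> real"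
  assumes [measurable]: "g \<in> borel_measurable borel" and "\<And>u. \<bar>g u\<bar> \<le> B"
  shows "integrable lborel (\<lambda>u. g u * std_normal_density u)"
proof -
  have "integrable lborel (\<lambda>u. B * std_normal_density u)"
    by (simp add: integrable_normal_density)
  then show ?thesis
    by (rule Bochner_Integration.integrable_bound)
       (use assms(2) in \<open>auto simp: abs_mult normal_density_nonneg intro!: AE_I2 mult_right_mono order_trans[OF assms(2) abs_ge_self]\<close>)
qed

text \<open>
  Thus \<open>sqrt (2 * pi) * \<theta> x\<close> is the Mills ratio of the standard normal law, the quotient of its tail
  and its density; this is the form in which \<open>\<theta>\<close> bounds solutions of Stein's equation.
\<close>
lemma theta_eq_tail:
  "(LINT u|lborel. indicator {x..} u * std_normal_density u) = sqrt (2 * pi) * \<theta> x * std_normal_density x"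
proof -
  have "(LINT u|lborel. indicator {x..} u * std_normal_density u)
      = (LINT u|lborel. 1 / sqrt (2*pi) * (indicator {x..} u * exp (- u\<^sup>2 / 2)))"
    by (intro Bochner_Integration.integral_cong) (auto simp: std_normal_density_def)
  also have "\<dots> = 1 / sqrt (2*pi) * (LBINT u:{x..}. exp (- u\<^sup>2 / 2))"
    by (simp add: set_lebesgue_integral_def)
  also have "\<dots> = sqrt (2 * pi) * \<theta> x * std_normal_density x"
    by (simp add: \<theta>_def std_normal_density_def exp_minus field_simps)
  finally show ?thesis .
qed

text \<open>
  Substitute \<open>u = x + v\<close> and expand the square. The right-hand side is \<open>E (exp (- x * Z); Z \<ge> 0)\<close> for a
  standard normal \<open>Z\<close>, which is what tilting produces, and it makes monotonicity and
  regularity of \<open>\<theta>\<close> visible under the integral.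
\<close>
lemma theta_eq_laplace:
  "\<theta> x = (LINT v|lborel. indicator {0..} v * exp (- (x * v)) * std_normal_density v)"
proof -
  have "(LBINT u:{x..}. exp (- u\<^sup>2 / 2)) = (LINT v|lborel. indicator {x..} (x + v) * exp (- (x + v)\<^sup>2 / 2))"
    unfolding set_lebesgue_integral_def
    by (subst lborel_integral_real_affine[where c=1 and t=x]) auto
  also have "\<dots> = (LINT v|lborel. exp (- x\<^sup>2 / 2) * (indicator {0..} v * exp (- (x * v)) * exp (- v\<^sup>2 / 2)))"
    by (intro Bochner_Integration.integral_cong)
       (auto simp: power2_eq_square field_simps mult_exp_exp split: split_indicator)
  finally have "\<theta> x = 1 / sqrt (2 * pi) * (LINT v|lborel. indicator {0..} v * exp (- (x * v)) * exp (- v\<^sup>2 / 2))"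
    by (simp add: \<theta>_def exp_minus)
  also have "\<dots> = (LINT v|lborel. 1 / sqrt (2 * pi) * (indicator {0..} v * exp (- (x * v)) * exp (- v\<^sup>2 / 2)))"
    by simp
  also have "\<dots> = (LINT v|lborel. indicator {0..} v * exp (- (x * v)) * std_normal_density v)"
    by (intro Bochner_Integration.integral_cong) (auto simp: std_normal_density_def)
  finally show ?thesis .
qed

lemma integrable_theta_laplace:
  assumes "x \<ge> 0"
  shows "integrable lborel (\<lambda>v. indicator {0..} v * exp (- (x * v)) * std_normal_density v)"
  using assms
  by (intro integrable_normal_mult[where B=1]) (auto split: split_indicator)

lemma theta_nonneg: "\<theta> x \<ge> 0"
  unfolding theta_eq_laplace
  by (intro Bochner_Integration.integral_nonneg) (auto simp: normal_density_nonneg)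

lemma theta_antimono:
  assumes "0 \<le> x" "x \<le> y"
  shows "\<theta> y \<le> \<theta> x"
  unfolding theta_eq_laplace
  using assms
  by (intro integral_mono integrable_theta_laplace mult_right_mono)
     (auto simp: normal_density_nonneg mult_right_mono split: split_indicator)

lemma erlang_integral:
  assumes "c > 0"
  shows "integrable lborel (erlang_density k c)" "(LINT v|lborel. erlang_density k c v) = 1"
proof -
  have "(\<integral>\<^sup>+v. ennreal (erlang_density k c v) \<partial>lborel) = ennreal 1"
    using nn_integral_erlang_ith_moment[OF assms, of k 0] by (simp add: mult.commute)
  then have "has_bochner_integral lborel (erlang_density k c) 1"
    using assms by (intro has_bochner_integral_nn_integral) (auto intro!: erlang_density_nonneg)
  then show "integrable lborel (erlang_density k c)" "(LINT v|lborel. erlang_density k c v) = 1"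
    by (auto simp: has_bochner_integral_iff)
qed

lemma std_normal_density_le: "sqrt (2 * pi) * std_normal_density v \<le> 1"
  by (simp add: std_normal_density_def)

lemma sqrt_2pi_bounds: "1 \<le> sqrt (2 * pi)" "sqrt (2 * pi) \<le> 3"
  using pi_gt3 pi_less_4 by (auto intro!: real_le_lsqrt)

text \<open>
  Drop one of the two factors in the Laplace form: without the exponential a probability remains,
  without the density the exponential law remains.
\<close>
lemma theta_mills:
  assumes "x \<ge> 0"
  shows "sqrt (2 * pi) * \<theta> x \<le> 3" "x * (sqrt (2 * pi) * \<theta> x) \<le> 1"
proof -
  have "\<theta> x \<le> (LINT v|lborel. std_normal_density v)"
    unfolding theta_eq_laplace using assms
    by (intro integral_mono integrable_theta_laplace)
       (auto simp: normal_density_nonneg integrable_normal_density mult_left_le_one_le split: split_indicator)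
  also have "\<dots> = 1" by (rule integral_normal_density) simp
  finally have "\<theta> x \<le> 1" .
  then show "sqrt (2 * pi) * \<theta> x \<le> 3"
    using sqrt_2pi_bounds mult_mono[of "sqrt (2*pi)" 3 "\<theta> x" 1] theta_nonneg[of x] by auto
  show "x * (sqrt (2 * pi) * \<theta> x) \<le> 1"
  proof (cases "x = 0")
    case False
    then have x: "x > 0" using assms by simp
    have "x * (sqrt (2 * pi) * \<theta> x)
        = (LINT v|lborel. x * sqrt (2 * pi) * (indicator {0..} v * exp (- (x * v)) * std_normal_density v))"
      unfolding theta_eq_laplace by simp
    also have "\<dots> \<le> (LINT v|lborel. erlang_density 0 x v)"
    proof (intro integral_mono integrable_mult_right integrable_theta_laplace assms erlang_integral x)
      fix v :: real
      have "exp (- (x * v)) * (sqrt (2*pi) * std_normal_density v) \<le> exp (- (x * v))"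
        using std_normal_density_le[of v] by (intro mult_left_le) auto
      from mult_left_mono[OF this assms]
      show "x * sqrt (2 * pi) * (indicator {0..} v * exp (- (x * v)) * std_normal_density v) \<le> erlang_density 0 x v"
        by (auto simp: erlang_density_def mult_ac split: split_indicator)
    qed
    finally show ?thesis using erlang_integral[OF x] by simp
  qed simp
qed

text \<open>
  Inside the Laplace form, \<open>exp (- r * x * v) - exp (- x * v)\<close> is at most \<open>(1 - r) * x * v * exp (- r * x * v)\<close>,
  which is a multiple of a Gamma density. Because the loss is of order
  \<open>(1 - r) / x\<close>, an error \<open>1 - r = \<delta> * x\<close> costs only \<open>O (\<delta>)\<close>, uniformly in \<open>x\<close>.
\<close>
lemma theta_scaling:
  assumes x: "x > 0" and r: "0 < r" "r \<le> 1"
  shows "\<theta> (r * x) \<le> \<theta> x + (1 - r) / (r\<^sup>2 * x)"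
proof -
  have rx: "r * x > 0" using x r by simp
  have "\<theta> (r * x) - \<theta> x = (LINT v|lborel. indicator {0..} v * exp (- (r * x * v)) * std_normal_density v
      - indicator {0..} v * exp (- (x * v)) * std_normal_density v)"
    unfolding theta_eq_laplace
    using rx x by (intro Bochner_Integration.integral_diff[symmetric] integrable_theta_laplace) auto
  also have "\<dots> \<le> (LINT v|lborel. (1 - r) / (r\<^sup>2 * x) * erlang_density 1 (r * x) v)"
  proof (intro integral_mono integrable_mult_right Bochner_Integration.integrable_diff integrable_theta_laplace erlang_integral)
    fix v :: real
    show "indicator {0..} v * exp (- (r * x * v)) * std_normal_density v
      - indicator {0..} v * exp (- (x * v)) * std_normal_density v
      \<le> (1 - r) / (r\<^sup>2 * x) * erlang_density 1 (r * x) v"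
    proof (cases "v \<ge> 0")
      case True
      have "1 + (- ((1 - r) * x * v)) \<le> exp (- ((1 - r) * x * v))" by (rule exp_ge_add_one_self)
      then have 1: "1 - exp (- ((1 - r) * x * v)) \<le> (1 - r) * x * v" by simp
      have "exp (- (r * x * v)) - exp (- (x * v)) = exp (- (r * x * v)) * (1 - exp (- ((1 - r) * x * v)))"
        by (simp add: algebra_simps mult_exp_exp)
      also have "\<dots> \<le> exp (- (r * x * v)) * ((1 - r) * x * v)"
        using 1 by (intro mult_left_mono) auto
      finally have 2: "exp (- (r * x * v)) - exp (- (x * v)) \<le> exp (- (r * x * v)) * ((1 - r) * x * v)" .
      have "std_normal_density v \<le> sqrt (2*pi) * std_normal_density v"
        using sqrt_2pi_bounds mult_right_mono[of 1 "sqrt (2*pi)" "std_normal_density v"] by (simp add: normal_density_nonneg)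
      also note std_normal_density_le[of v]
      finally have 3: "std_normal_density v \<le> 1" .
      have 4: "0 \<le> exp (- (r * x * v)) * ((1 - r) * x * v)"
        using r x True by auto
      have "(exp (- (r * x * v)) - exp (- (x * v))) * std_normal_density v
          \<le> (exp (- (r * x * v)) * ((1 - r) * x * v)) * 1"
        using 2 3 4 by (intro mult_mono) (auto simp: normal_density_nonneg)
      also have "\<dots> = (1 - r) / (r\<^sup>2 * x) * erlang_density 1 (r * x) v"
        using True r x by (simp add: erlang_density_def power2_eq_square field_simps)
      finally show ?thesis using True by (simp add: left_diff_distrib)
    qed (simp add: erlang_density_def)
  qed (use rx x in auto)
  also have "\<dots> = (1 - r) / (r\<^sup>2 * x)" using erlang_integral[OF rx] by simp
  finally show ?thesis by simp
qed


section \<open>Stein's equation for the normal law\<close>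

lemma has_real_derivative_lower_integral:
  fixes q :: "real \<Rightarrow> real"
  assumes cont: "continuous_on UNIV q" and int: "integrable lborel q"
  shows "((\<lambda>x. LINT u|lborel. indicator {..x} u * q u) has_real_derivative q x) (at x)"
proof -
  define A where "A = (\<lambda>x. LINT u|lborel. indicator {..x} u * q u)"
  have int_ind: "integrable lborel (\<lambda>u. indicator S u * q u)" if "S \<in> sets borel" for S
    using int that integrable_mult_indicator[of S lborel q] by simp
  have split: "A z = A (x - 1) + integral {x - 1..z} q" if "x - 1 \<le> z" for z
  proof -
    have "A z = (LINT u|lborel. indicator {..x - 1} u * q u + indicator {x - 1<..z} u * q u)"
      unfolding A_def using that by (intro Bochner_Integration.integral_cong) (auto split: split_indicator)
    also have "\<dots> = A (x - 1) + (LINT u|lborel. indicator {x - 1<..z} u * q u)"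
      unfolding A_def by (intro Bochner_Integration.integral_add int_ind) auto
    also have "(LINT u|lborel. indicator {x - 1<..z} u * q u) = (LINT u|lborel. indicator {x - 1..z} u * q u)"
      using AE_lborel_singleton[of "x - 1"]
      by (intro integral_cong_AE) (use int_ind in \<open>auto split: split_indicator\<close>)
    also have "\<dots> = integral {x - 1..z} q"
      using set_borel_integral_eq_integral(2)[of "{x - 1..z}" q] int_ind[of "{x-1..z}"]
      by (simp add: set_lebesgue_integral_def set_integrable_def)
    finally show ?thesis .
  qed
  have "((\<lambda>z. integral {x - 1..z} q) has_real_derivative q x) (at x within {x - 1..x + 1})"
    by (rule integral_has_real_derivative) (auto intro: continuous_on_subset[OF cont])
  then have "((\<lambda>z. integral {x - 1..z} q) has_real_derivative q x) (at x)"
    by (simp add: at_within_Icc_at)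
  then have "((\<lambda>z. A (x - 1) + integral {x - 1..z} q) has_real_derivative q x) (at x)"
    by (auto intro!: derivative_eq_intros)
  moreover have "eventually (\<lambda>z. A z = A (x - 1) + integral {x - 1..z} q) (nhds x)"
    using eventually_nhds_in_open[of "{x-1<..}" x] by (rule eventually_mono) (auto intro!: split)
  ultimately have "(A has_real_derivative q x) (at x)"
    by (subst DERIV_cong_ev[OF refl _ refl])
  then show ?thesis by (simp add: A_def)
qed

text \<open>
  The solution of \<open>f' x = x * f x + h x - N\<close> with integrating factor \<open>std_normal_density\<close> is the integral of
  \<open>(h - N) * std_normal_density\<close> up to \<open>x\<close>, divided by \<open>std_normal_density x\<close>. Since the full integral vanishes, the
  integral over either side of \<open>x\<close> may be used; on the side away from \<open>0\<close> it is at most a Gaussian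
  tail, and the Mills ratio bounds give the estimates for \<open>f\<close> and \<open>x * f x\<close>.
\<close>
lemma stein_solution:
  fixes h :: "real \<Rightarrow> real"
  defines "N \<equiv> LINT u|lborel. h u * std_normal_density u"
  assumes cont: "continuous_on UNIV h" and h01: "\<And>x. 0 \<le> h x" "\<And>x. h x \<le> 1"
  obtains f where "\<And>x. (f has_real_derivative x * f x + h x - N) (at x)"
    "\<And>x. \<bar>f x\<bar> \<le> 3" "\<And>x. \<bar>x * f x + h x - N\<bar> \<le> 2"
proof -
  note [measurable] = borel_measurable_continuous_onI[OF cont]
  have int1: "integrable lborel std_normal_density" "(LINT u|lborel. std_normal_density u) = 1"
    by (auto simp: integrable_normal_density integral_normal_density)
  have inth: "integrable lborel (\<lambda>u. h u * std_normal_density u)"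
    by (rule integrable_normal_mult[where B=1]) (use h01 in auto)
  have N0: "0 \<le> N"
    unfolding N_def by (intro Bochner_Integration.integral_nonneg) (auto simp: h01 normal_density_nonneg)
  have "N \<le> (LINT u|lborel. std_normal_density u)"
    unfolding N_def by (intro integral_mono inth int1) (auto simp: h01 normal_density_nonneg mult_left_le_one_le)
  then have N1: "N \<le> 1" using int1 by simp
  define g where "g = (\<lambda>u. h u - N)"
  have g: "\<bar>g u\<bar> \<le> 1" for u using N0 N1 h01[of u] by (auto simp: g_def)
  define q where "q = (\<lambda>u. g u * std_normal_density u)"
  have contphi: "continuous_on UNIV std_normal_density"
    unfolding std_normal_density_def by (intro continuous_intros) auto
  have contq: "continuous_on UNIV q"
    unfolding q_def g_def by (intro continuous_intros cont contphi)
  have qle: "\<bar>q u\<bar> \<le> std_normal_density u" for u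
    using g[of u] by (auto simp: q_def abs_mult normal_density_nonneg mult_left_le_one_le)
  have intq: "integrable lborel q"
    unfolding q_def by (rule integrable_normal_mult[where B=1]) (use g in \<open>auto simp: g_def\<close>)
  have q0: "(LINT u|lborel. q u) = 0"
  proof -
    have "(LINT u|lborel. q u) = (LINT u|lborel. h u * std_normal_density u - N * std_normal_density u)"
      by (intro Bochner_Integration.integral_cong) (auto simp: q_def g_def algebra_simps)
    also have "\<dots> = N - N * 1"
      using int1 inth by (subst Bochner_Integration.integral_diff) (auto simp: N_def)
    finally show ?thesis by simp
  qed
  define A where "A = (\<lambda>x. LINT u|lborel. indicator {..x} u * q u)"
  have int_ind: "integrable lborel (\<lambda>u. indicator S u * q u)"
    "integrable lborel (\<lambda>u. indicator S u * std_normal_density u)" if "S \<in> sets borel" for S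
    using intq int1 that integrable_mult_indicator[of S lborel q]
      integrable_mult_indicator[of S lborel std_normal_density] by simp_all
  have A': "(A has_real_derivative q x) (at x)" for x
    unfolding A_def by (rule has_real_derivative_lower_integral[OF contq intq])
  \<comment> \<open>the Mills ratio\<close>
  define R where "R = (\<lambda>x. sqrt (2 * pi) * \<theta> x)"
  have tail_abs: "\<bar>LINT u|lborel. indicator S u * q u\<bar> \<le> (LINT u|lborel. indicator S u * std_normal_density u)"
    if "S \<in> sets borel" for S
  proof -
    have "\<bar>LINT u|lborel. indicator S u * q u\<bar> \<le> (LINT u|lborel. \<bar>indicator S u * q u\<bar>)"
      by (rule integral_abs_bound)
    also have "\<dots> \<le> (LINT u|lborel. indicator S u * std_normal_density u)"
      by (intro integral_mono integrable_abs int_ind that) (use qle in \<open>auto split: split_indicator\<close>)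
    finally show ?thesis .
  qed
  have A_pos: "\<bar>A x\<bar> \<le> R \<bar>x\<bar> * std_normal_density x" for x
  proof (cases "x \<ge> 0")
    case True
    have "(LINT u|lborel. q u) = (LINT u|lborel. indicator {..x} u * q u + indicator {x<..} u * q u)"
      by (intro Bochner_Integration.integral_cong) (auto split: split_indicator)
    also have "\<dots> = A x + (LINT u|lborel. indicator {x<..} u * q u)"
      unfolding A_def by (intro Bochner_Integration.integral_add int_ind) auto
    finally have "\<bar>A x\<bar> = \<bar>LINT u|lborel. indicator {x<..} u * q u\<bar>"
      using q0 by simp
    also have "\<dots> \<le> (LINT u|lborel. indicator {x<..} u * std_normal_density u)"
      by (rule tail_abs) auto
    also have "\<dots> \<le> (LINT u|lborel. indicator {x..} u * std_normal_density u)"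
      by (intro integral_mono int_ind) (auto simp: normal_density_nonneg split: split_indicator)
    finally show ?thesis using True by (simp add: theta_eq_tail R_def)
  next
    case False
    have "\<bar>A x\<bar> \<le> (LINT u|lborel. indicator {..x} u * std_normal_density u)"
      unfolding A_def by (rule tail_abs) auto
    also have "\<dots> = (LINT u|lborel. indicator {-x..} u * std_normal_density u)"
      by (subst lborel_integral_real_affine[where c="-1" and t=0])
         (auto simp: std_normal_density_def intro!: Bochner_Integration.integral_cong split: split_indicator)
    finally show ?thesis using False unfolding theta_eq_tail by (simp add: R_def std_normal_density_def)
  qed
  define f where "f = (\<lambda>x. A x / std_normal_density x)"
  have phi_pos: "std_normal_density x > 0" for x by (rule normal_density_pos) simp
  have f_le: "\<bar>f x\<bar> \<le> R \<bar>x\<bar>" for x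
    using A_pos[of x] phi_pos[of x] by (simp add: f_def abs_divide pos_divide_le_eq)
  have f3: "\<bar>f x\<bar> \<le> 3" for x
    using f_le[of x] theta_mills(1)[of "\<bar>x\<bar>"] by (simp add: R_def)
  have "\<bar>x * f x\<bar> \<le> 1" for x
  proof -
    have "\<bar>x * f x\<bar> \<le> \<bar>x\<bar> * R \<bar>x\<bar>" using f_le[of x] by (simp add: abs_mult mult_left_mono)
    also have "\<dots> \<le> 1" using theta_mills(2)[of "\<bar>x\<bar>"] by (simp add: R_def)
    finally show ?thesis .
  qed
  then have f2: "\<bar>x * f x + h x - N\<bar> \<le> 2" for x
    using g[of x] abs_triangle_ineq[of "x * f x" "h x - N"] by (smt (verit) g_def)
  have phi': "(std_normal_density has_real_derivative - x * std_normal_density x) (at x)" for x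
  proof -
    have "((\<lambda>x. c * exp (- x\<^sup>2 / 2)) has_real_derivative - x * (c * exp (- x\<^sup>2 / 2))) (at x)" for c :: real
      by (auto intro!: derivative_eq_intros)
    then show ?thesis unfolding std_normal_density_def .
  qed
  have "(f has_real_derivative x * f x + h x - N) (at x)" for x
  proof -
    have "(f has_real_derivative (q x * std_normal_density x - A x * (- x * std_normal_density x))
        / (std_normal_density x * std_normal_density x)) (at x)"
      unfolding f_def using phi_pos[of x] by (intro DERIV_divide A' phi') auto
    also have "(q x * std_normal_density x - A x * (- x * std_normal_density x))
        / (std_normal_density x * std_normal_density x) = x * f x + h x - N"
      using phi_pos[of x] by (simp add: f_def q_def g_def field_simps)
    finally show ?thesis .
  qed
  with f3 f2 show thesis using that by blast
qed


section \<open>Normal approximation of sums of bounded variables\<close>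

text \<open>
  The form of independence that Stein's method uses: \<open>\<xi> i\<close> is centered with second moment \<open>v i\<close> and
  does not correlate, to these two orders, with functions of the sum of the others. It is preferred to
  independence because it can be read off directly for a tilted measure. The test functions \<open>g\<close>
  need to be bounded only along the values that are taken, so unbounded functions such as the identity are
  admissible.
\<close>
locale leave_one_out = prob_space Q for Q :: "'a measure" +
  fixes I :: "'i set" and \<xi> :: "'i \<Rightarrow> 'a \<Rightarrow> real" and v :: "'i \<Rightarrow> real" and a :: real
    and W :: "'a \<Rightarrow> real"
  defines "W \<equiv> \<lambda>\<omega>. \<Sum>i\<in>I. \<xi> i \<omega>"
  assumes fin: "finite I"
    and meas: "i \<in> I \<Longrightarrow> \<xi> i \<in> borel_measurable Q"
    and bdd: "i \<in> I \<Longrightarrow> \<bar>\<xi> i \<omega>\<bar> \<le> a"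
    and a_pos: "a > 0"
    and first_moment: "\<And>i g B. \<lbrakk>i \<in> I; g \<in> borel_measurable borel; \<And>\<omega>. \<bar>g (W \<omega> - \<xi> i \<omega>)\<bar> \<le> (B :: real)\<rbrakk>
      \<Longrightarrow> expectation (\<lambda>\<omega>. \<xi> i \<omega> * g (W \<omega> - \<xi> i \<omega>)) = 0"
    and second_moment: "\<And>i g B. \<lbrakk>i \<in> I; g \<in> borel_measurable borel; \<And>\<omega>. \<bar>g (W \<omega> - \<xi> i \<omega>)\<bar> \<le> (B :: real)\<rbrakk>
      \<Longrightarrow> expectation (\<lambda>\<omega>. (\<xi> i \<omega>)\<^sup>2 * g (W \<omega> - \<xi> i \<omega>)) = v i * expectation (\<lambda>\<omega>. g (W \<omega> - \<xi> i \<omega>))"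
    and sum_v: "(\<Sum>i\<in>I. v i) = 1"
begin

lemma W_meas[measurable]: "W \<in> borel_measurable Q"
  unfolding W_def using meas by measurable

lemma int_bounded:
  fixes f :: "'a \<Rightarrow> real"
  assumes "f \<in> borel_measurable Q" "\<And>\<omega>. \<bar>f \<omega>\<bar> \<le> B"
  shows "integrable Q f"
  using assms by (intro integrable_const_bound[where B=B]) auto

definition W_max :: real where "W_max = (real (card I) + 1) * a"

lemma W_bdd: "\<bar>W \<omega>\<bar> \<le> W_max" and W_loo_bdd: "i \<in> I \<Longrightarrow> \<bar>W \<omega> - \<xi> i \<omega>\<bar> \<le> W_max"
proof -
  have "\<bar>W \<omega>\<bar> \<le> (\<Sum>i\<in>I. \<bar>\<xi> i \<omega>\<bar>)" unfolding W_def by (rule sum_abs)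
  also have "\<dots> \<le> (\<Sum>i\<in>I. a)" by (intro sum_mono bdd)
  finally have 1: "\<bar>W \<omega>\<bar> \<le> real (card I) * a" by simp
  then show "\<bar>W \<omega>\<bar> \<le> W_max" using a_pos by (simp add: W_max_def algebra_simps)
  show "\<bar>W \<omega> - \<xi> i \<omega>\<bar> \<le> W_max" if "i \<in> I"
    using 1 bdd[OF that, of \<omega>] by (simp add: W_max_def algebra_simps)
qed

lemma v_nonneg: assumes "i \<in> I" shows "v i \<ge> 0"
proof -
  have "v i = expectation (\<lambda>\<omega>. (\<xi> i \<omega>)\<^sup>2)"
    using second_moment[OF assms, of "\<lambda>_. 1" 1] by (simp add: prob_space)
  then show ?thesis by simp
qed

lemma expectation_W_mult:
  assumes f[measurable]: "f \<in> borel_measurable borel" and B: "\<And>x. \<bar>x\<bar> \<le> W_max \<Longrightarrow> \<bar>f x\<bar> \<le> B"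
  shows "expectation (\<lambda>\<omega>. W \<omega> * f (W \<omega>))
    = (\<Sum>i\<in>I. expectation (\<lambda>\<omega>. \<xi> i \<omega> * (f (W \<omega>) - f (W \<omega> - \<xi> i \<omega>))))"
proof -
  have fW: "\<bar>f (W \<omega>)\<bar> \<le> B" for \<omega>
    using W_bdd by (intro B)
  have fWi: "\<bar>f (W \<omega> - \<xi> i \<omega>)\<bar> \<le> B" if "i \<in> I" for \<omega> i
    using W_loo_bdd[OF that] by (intro B)
  have int1: "integrable Q (\<lambda>\<omega>. \<xi> i \<omega> * f (W \<omega>))" if i: "i \<in> I" for i
  proof (rule int_bounded[where B="a * B"])
    note [measurable] = meas[OF i]
    show "(\<lambda>\<omega>. \<xi> i \<omega> * f (W \<omega>)) \<in> borel_measurable Q" by measurable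
    show "\<bar>\<xi> i \<omega> * f (W \<omega>)\<bar> \<le> a * B" for \<omega>
      unfolding abs_mult using bdd[OF i] fW a_pos by (intro mult_mono) auto
  qed
  have int2: "integrable Q (\<lambda>\<omega>. \<xi> i \<omega> * f (W \<omega> - \<xi> i \<omega>))" if i: "i \<in> I" for i
  proof (rule int_bounded[where B="a * B"])
    note [measurable] = meas[OF i]
    show "(\<lambda>\<omega>. \<xi> i \<omega> * f (W \<omega> - \<xi> i \<omega>)) \<in> borel_measurable Q" by measurable
    show "\<bar>\<xi> i \<omega> * f (W \<omega> - \<xi> i \<omega>)\<bar> \<le> a * B" for \<omega>
      unfolding abs_mult using bdd[OF i] fWi[OF i] a_pos by (intro mult_mono) auto
  qed
  have "expectation (\<lambda>\<omega>. W \<omega> * f (W \<omega>)) = expectation (\<lambda>\<omega>. \<Sum>i\<in>I. \<xi> i \<omega> * f (W \<omega>))"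
    unfolding W_def sum_distrib_right ..
  also have "\<dots> = (\<Sum>i\<in>I. expectation (\<lambda>\<omega>. \<xi> i \<omega> * f (W \<omega>)))"
    by (intro Bochner_Integration.integral_sum int1)
  also have "\<dots> = (\<Sum>i\<in>I. expectation (\<lambda>\<omega>. \<xi> i \<omega> * f (W \<omega>)) - expectation (\<lambda>\<omega>. \<xi> i \<omega> * f (W \<omega> - \<xi> i \<omega>)))"
    by (intro sum.cong refl) (use first_moment[OF _ f fWi] in simp)
  also have "\<dots> = (\<Sum>i\<in>I. expectation (\<lambda>\<omega>. \<xi> i \<omega> * (f (W \<omega>) - f (W \<omega> - \<xi> i \<omega>))))"
    by (intro sum.cong refl) (subst Bochner_Integration.integral_diff[symmetric], auto intro: int1 int2 simp: right_diff_distrib)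
  finally show ?thesis .
qed

text \<open>
  The lower half of the leave-one-out expansion of \<open>E (W * f W)\<close>: if \<open>g\<close> minorises the difference quotients
  of \<open>f\<close> at distance at most \<open>a\<close>, then \<open>E (W * f W)\<close> is at least an average of the \<open>E (g (W - \<xi> i))\<close>.
  Concentration and normal approximation are both instances.
\<close>
lemma expectation_W_mult_ge:
  assumes f[measurable]: "f \<in> borel_measurable borel" and B: "\<And>x. \<bar>x\<bar> \<le> W_max \<Longrightarrow> \<bar>f x\<bar> \<le> B"
    and g[measurable]: "g \<in> borel_measurable borel" and B': "\<And>x. \<bar>x\<bar> \<le> W_max \<Longrightarrow> \<bar>g x\<bar> \<le> B'"
    and le: "\<And>x z. \<bar>z\<bar> \<le> a \<Longrightarrow> z\<^sup>2 * g x \<le> z * (f (x + z) - f x)"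
  shows "(\<Sum>i\<in>I. v i * expectation (\<lambda>\<omega>. g (W \<omega> - \<xi> i \<omega>))) \<le> expectation (\<lambda>\<omega>. W \<omega> * f (W \<omega>))"
proof (subst expectation_W_mult[OF f B], assumption, rule sum_mono)
  fix i assume i: "i \<in> I"
  note [measurable] = meas[OF i]
  have gB: "\<bar>g (W \<omega> - \<xi> i \<omega>)\<bar> \<le> B'" "\<bar>f (W \<omega> - \<xi> i \<omega>)\<bar> \<le> B" "\<bar>f (W \<omega>)\<bar> \<le> B" for \<omega>
    using W_loo_bdd[OF i, of \<omega>] W_bdd[of \<omega>] by (auto intro!: B B')
  have "v i * expectation (\<lambda>\<omega>. g (W \<omega> - \<xi> i \<omega>)) = expectation (\<lambda>\<omega>. (\<xi> i \<omega>)\<^sup>2 * g (W \<omega> - \<xi> i \<omega>))"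
    by (rule second_moment[OF i g gB(1), symmetric])
  also have "\<dots> \<le> expectation (\<lambda>\<omega>. \<xi> i \<omega> * (f (W \<omega>) - f (W \<omega> - \<xi> i \<omega>)))"
  proof (intro integral_mono)
    show "integrable Q (\<lambda>\<omega>. (\<xi> i \<omega>)\<^sup>2 * g (W \<omega> - \<xi> i \<omega>))"
    proof (rule int_bounded[where B="a\<^sup>2 * B'"])
      show "\<bar>(\<xi> i \<omega>)\<^sup>2 * g (W \<omega> - \<xi> i \<omega>)\<bar> \<le> a\<^sup>2 * B'" for \<omega>
        unfolding abs_mult using gB bdd[OF i, of \<omega>] a_pos
        by (intro mult_mono) (auto simp: abs_le_square_iff[symmetric])
    qed measurable
    show "integrable Q (\<lambda>\<omega>. \<xi> i \<omega> * (f (W \<omega>) - f (W \<omega> - \<xi> i \<omega>)))"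
    proof (rule int_bounded[where B="a * (B + B)"])
      show "\<bar>\<xi> i \<omega> * (f (W \<omega>) - f (W \<omega> - \<xi> i \<omega>))\<bar> \<le> a * (B + B)" for \<omega>
        unfolding abs_mult using gB(2,3)[of \<omega>] bdd[OF i, of \<omega>] a_pos
        by (intro mult_mono) (auto intro: order_trans[OF abs_triangle_ineq4])
    qed measurable
    show "(\<xi> i \<omega>)\<^sup>2 * g (W \<omega> - \<xi> i \<omega>) \<le> \<xi> i \<omega> * (f (W \<omega>) - f (W \<omega> - \<xi> i \<omega>))" for \<omega>
      using le[OF bdd[OF i, of \<omega>], of "W \<omega> - \<xi> i \<omega>"] by simp
  qed
  finally show "v i * expectation (\<lambda>\<omega>. g (W \<omega> - \<xi> i \<omega>)) \<le> expectation (\<lambda>\<omega>. \<xi> i \<omega> * (f (W \<omega>) - f (W \<omega> - \<xi> i \<omega>)))" .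
qed

lemma int_W:
  fixes g :: "real \<Rightarrow> real"
  shows "g \<in> borel_measurable borel \<Longrightarrow> (\<And>x. \<bar>x\<bar> \<le> W_max \<Longrightarrow> \<bar>g x\<bar> \<le> B) \<Longrightarrow> integrable Q (\<lambda>\<omega>. g (W \<omega>))"
  using W_bdd by (intro int_bounded[where B=B]) auto

lemma int_W_loo:
  fixes g :: "real \<Rightarrow> real"
  shows "i \<in> I \<Longrightarrow> g \<in> borel_measurable borel \<Longrightarrow> (\<And>x. \<bar>x\<bar> \<le> W_max \<Longrightarrow> \<bar>g x\<bar> \<le> B)
   \<Longrightarrow> integrable Q (\<lambda>\<omega>. g (W \<omega> - \<xi> i \<omega>))"
  using W_loo_bdd meas by (intro int_bounded[where B=B]) auto

lemma expectation_abs_W: "expectation (\<lambda>\<omega>. \<bar>W \<omega>\<bar>) \<le> 1"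
proof -
  have "expectation (\<lambda>\<omega>. W \<omega> * W \<omega>) = (\<Sum>i\<in>I. expectation (\<lambda>\<omega>. \<xi> i \<omega> * (W \<omega> - (W \<omega> - \<xi> i \<omega>))))"
    by (rule expectation_W_mult[of "\<lambda>x. x" "W_max"]) auto
  also have "\<dots> = (\<Sum>i\<in>I. v i)"
    using second_moment[where g="\<lambda>_. 1" and B=1] by (intro sum.cong) (auto simp: prob_space power2_eq_square)
  finally have 1: "expectation (\<lambda>\<omega>. W \<omega> * W \<omega>) = 1" by (simp add: sum_v)
  have int: "integrable Q (\<lambda>\<omega>. W \<omega> * W \<omega>)" "integrable Q (\<lambda>\<omega>. \<bar>W \<omega>\<bar>)"
    using int_W[of "\<lambda>x. x * x" "(W_max)\<^sup>2"] int_W[of "\<lambda>x. \<bar>x\<bar>" "W_max"]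
    by (auto simp: power2_eq_square abs_le_square_iff[unfolded power2_eq_square, symmetric])
  have "expectation (\<lambda>\<omega>. \<bar>W \<omega>\<bar>) \<le> expectation (\<lambda>\<omega>. 1 / 2 + 1 / 2 * (W \<omega> * W \<omega>))"
  proof (intro integral_mono int Bochner_Integration.integrable_add integrable_mult_right)
    show "\<bar>W \<omega>\<bar> \<le> 1 / 2 + 1 / 2 * (W \<omega> * W \<omega>)" for \<omega>
      using zero_le_power2[of "\<bar>W \<omega>\<bar> - 1"] by (simp add: power2_eq_square algebra_simps)
  qed auto
  also have "\<dots> = 1" using int 1 by (simp add: prob_space)
  finally show ?thesis .
qed

text \<open>
  Apply the expansion to a truncated identity \<open>f\<close> that has slope \<open>1\<close> on the interval enlarged by \<open>2 * a\<close>
  and is constant outside. Since \<open>\<bar>f\<bar>\<close> is bounded by half the length of the enlarged interval and \<open>E \<bar>W\<bar> \<le> 1\<close>,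
  so is \<open>E (W * f W)\<close>; and \<open>E (W * f W)\<close> dominates the probability, because leaving out one summand moves \<open>W\<close> by at most \<open>a\<close>.
\<close>
lemma concentration:
  assumes uw: "u \<le> w"
  shows "expectation (\<lambda>\<omega>. indicator {u..w} (W \<omega>)) \<le> (w - u) / 2 + 2 * a"
proof -
  define L where "L = (w - u) / 2 + 2 * a"
  define f where "f = (\<lambda>x. max (- L) (min L (x - (u + w) / 2)))"
  have L: "L > 0" using uw a_pos by (simp add: L_def add_nonneg_pos)
  have f[measurable]: "f \<in> borel_measurable borel" unfolding f_def by measurable
  have fL: "\<bar>f x\<bar> \<le> L" for x using L by (auto simp: f_def)
  have mono: "f x \<le> f y" if "x \<le> y" for x y using that by (auto simp: f_def)
  let ?g = "\<lambda>x. indicator {u - a..w + a} x :: real"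
  have lin: "f x = x - (u + w) / 2" if "u - 2 * a \<le> x" "x \<le> w + 2 * a" for x
    using that by (auto simp: f_def L_def field_simps min_def max_def)
  have "expectation (\<lambda>\<omega>. indicator {u..w} (W \<omega>))
      = (\<Sum>i\<in>I. v i * expectation (\<lambda>\<omega>. indicator {u..w} (W \<omega>)))"
    by (simp add: sum_v flip: sum_distrib_right)
  also have "\<dots> \<le> (\<Sum>i\<in>I. v i * expectation (\<lambda>\<omega>. ?g (W \<omega> - \<xi> i \<omega>)))"
  proof (intro sum_mono mult_left_mono integral_mono v_nonneg)
    fix i assume i: "i \<in> I"
    show "integrable Q (\<lambda>\<omega>. indicator {u..w} (W \<omega>) :: real)" by (rule int_W[where B=1]) (auto split: split_indicator)
    show "integrable Q (\<lambda>\<omega>. ?g (W \<omega> - \<xi> i \<omega>))" by (rule int_W_loo[where B=1]) (auto simp: i split: split_indicator)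
    show "indicator {u..w} (W \<omega>) \<le> ?g (W \<omega> - \<xi> i \<omega>)" for \<omega>
      using bdd[OF i, of \<omega>] by (auto split: split_indicator)
  qed
  also have "\<dots> \<le> expectation (\<lambda>\<omega>. W \<omega> * f (W \<omega>))"
  proof (rule expectation_W_mult_ge[OF f])
    fix x z :: real assume z: "\<bar>z\<bar> \<le> a"
    show "z\<^sup>2 * ?g x \<le> z * (f (x + z) - f x)"
    proof (cases "x \<in> {u - a..w + a}")
      case True
      then have "f (x + z) - f x = z" using z lin[of x] lin[of "x + z"] by (simp add: abs_le_iff)
      then show ?thesis using True by (simp add: power2_eq_square)
    next
      case False
      have "0 \<le> z * (f (x + z) - f x)"
        using mono[of x "x + z"] mono[of "x + z" x] by (cases "z \<ge> 0") (auto intro: mult_nonpos_nonpos)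
      then show ?thesis using False by simp
    qed
  qed (use fL in \<open>auto split: split_indicator\<close>)
  also have "\<dots> \<le> expectation (\<lambda>\<omega>. L * \<bar>W \<omega>\<bar>)"
  proof (intro integral_mono)
    show "integrable Q (\<lambda>\<omega>. W \<omega> * f (W \<omega>))"
      by (rule int_W[where g="\<lambda>x. x * f x" and B="W_max * L"])
         (use fL in \<open>auto simp: abs_mult intro!: mult_mono\<close>)
    show "integrable Q (\<lambda>\<omega>. L * \<bar>W \<omega>\<bar>)"
      by (intro integrable_mult_right int_W[where g=abs and B="W_max"]) auto
    show "W \<omega> * f (W \<omega>) \<le> L * \<bar>W \<omega>\<bar>" for \<omega>
    proof -
      have "W \<omega> * f (W \<omega>) \<le> \<bar>W \<omega>\<bar> * \<bar>f (W \<omega>)\<bar>" by (metis abs_ge_self abs_mult)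
      also have "\<dots> \<le> \<bar>W \<omega>\<bar> * L" using fL by (intro mult_left_mono) auto
      finally show ?thesis by (simp add: mult.commute)
    qed
  qed
  also have "\<dots> \<le> L" using L expectation_abs_W by (simp add: mult_left_le)
  finally show ?thesis by (simp add: L_def)
qed

text \<open>
  If \<open>f\<close> solves Stein's equation for \<open>h\<close>, then \<open>E (h W) - N = E (f' W) - E (W * f W)\<close>, and the
  leave-one-out expansion makes the right-hand side as small as the oscillation of \<open>f'\<close> on the scale \<open>a\<close>.
  By the equation, \<open>f'\<close> inherits its oscillation from \<open>x * f x\<close>, which contributes \<open>O (a)\<close>, and from \<open>h\<close>,
  which by assumption varies only on two short intervals; these have probability \<open>O (a)\<close> by
  concentration. So \<open>h\<close> may have slope \<open>1 / a\<close>.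
\<close>
lemma stein_bound:
  fixes h :: "real \<Rightarrow> real"
  assumes cont: "continuous_on UNIV h" and h01: "\<And>x. 0 \<le> h x" "\<And>x. h x \<le> 1"
    and var: "\<And>x y. \<bar>y - x\<bar> \<le> a \<Longrightarrow> \<bar>h y - h x\<bar> \<le> indicator {c..c + 3 * a} x + indicator {d..d + 3 * a} x"
    and a1: "a \<le> 1"
  shows "expectation (\<lambda>\<omega>. h (W \<omega>)) \<le> (LINT u|lborel. h u * std_normal_density u) + 32 * a"
proof -
  define N where "N = (LINT u|lborel. h u * std_normal_density u)"
  obtain f where f': "\<And>x. (f has_real_derivative x * f x + h x - N) (at x)"
    and f3: "\<And>x. \<bar>f x\<bar> \<le> 3" and f2: "\<And>x. \<bar>x * f x + h x - N\<bar> \<le> 2"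
    using stein_solution[OF cont h01] unfolding N_def by blast
  have contf: "continuous_on UNIV f"
    using f' by (intro continuous_at_imp_continuous_on ballI DERIV_isCont) auto
  note [measurable] = borel_measurable_continuous_onI[OF cont] borel_measurable_continuous_onI[OF contf]
  define F where "F = (\<lambda>x. x * f x + h x - N)"
  have [measurable]: "F \<in> borel_measurable borel" unfolding F_def by measurable
  have F2: "\<bar>F x\<bar> \<le> 2" for x using f2 by (simp add: F_def)
  have lip: "\<bar>f y - f x\<bar> \<le> 2 * \<bar>y - x\<bar>" for x y
    using field_differentiable_bound[of UNIV f F 2 y x] f' F2 by (auto simp: F_def)
  define G where "G = (\<lambda>x. 3 * a + 2 * a * \<bar>x\<bar> + indicator {c..c + 3 * a} x + indicator {d..d + 3 * a} x)"
  have [measurable]: "G \<in> borel_measurable borel" unfolding G_def by measurable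
  have FG: "\<bar>F y - F x\<bar> \<le> G x" if "\<bar>y - x\<bar> \<le> a" for x y
  proof -
    have "F y - F x = (y - x) * f y + x * (f y - f x) + (h y - h x)" by (simp add: F_def algebra_simps)
    then have "\<bar>F y - F x\<bar> \<le> \<bar>(y - x) * f y\<bar> + \<bar>x * (f y - f x)\<bar> + \<bar>h y - h x\<bar>" by linarith
    moreover have "\<bar>(y - x) * f y\<bar> \<le> a * 3"
      unfolding abs_mult using that f3[of y] a_pos by (intro mult_mono) auto
    moreover have "\<bar>x * (f y - f x)\<bar> \<le> \<bar>x\<bar> * (2 * a)"
      unfolding abs_mult using that lip[of y x] by (intro mult_left_mono) auto
    ultimately show ?thesis using var[OF that] by (simp add: G_def algebra_simps)
  qed
  define BG where "BG = 3 * a + 2 * a * (W_max) + 2"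
  have G_BG: "\<bar>G x\<bar> \<le> BG" if "\<bar>x\<bar> \<le> W_max" for x
  proof -
    have *: "2 * a * \<bar>x\<bar> \<le> 2 * a * (W_max)" using that a_pos by (intro mult_left_mono) auto
    have "\<bar>G x\<bar> = G x" unfolding G_def using a_pos by (intro abs_of_nonneg) simp
    also have "\<dots> \<le> 3 * a + 2 * a * W_max + 1 + 1"
      unfolding G_def by (intro add_mono * order_refl) (auto split: split_indicator)
    finally show ?thesis by (simp add: BG_def)
  qed
  have FG_B: "\<bar>F x + G x\<bar> \<le> 2 + BG" "\<bar>F x - G x\<bar> \<le> 2 + BG" if "\<bar>x\<bar> \<le> W_max" for x
    using G_BG[OF that] F2[of x] by linarith+
  \<comment> \<open>the three terms of \<open>G\<close> contribute at most \<open>3 * a\<close>, \<open>2 * a * (1 + a)\<close> and \<open>2 * (9 / 2) * a\<close>; intervals grow by \<open>a\<close> on each side when passing from \<open>W - \<xi> i\<close> to \<open>W\<close>\<close>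
  have EG: "expectation (\<lambda>\<omega>. G (W \<omega> - \<xi> i \<omega>)) \<le> 16 * a" if i: "i \<in> I" for i
  proof -
    let ?J = "\<lambda>c x. indicator {c - a..c + 4 * a} x :: real"
    have intJ: "integrable Q (\<lambda>\<omega>. ?J c (W \<omega>))" for c
      by (rule int_W[where B=1]) (auto split: split_indicator)
    have intabs: "integrable Q (\<lambda>\<omega>. \<bar>W \<omega>\<bar>)"
      by (rule int_W[where g=abs and B="W_max"]) auto
    have "expectation (\<lambda>\<omega>. G (W \<omega> - \<xi> i \<omega>))
        \<le> expectation (\<lambda>\<omega>. (3 * a + 2 * a * a) + 2 * a * \<bar>W \<omega>\<bar> + ?J c (W \<omega>) + ?J d (W \<omega>))"
    proof (intro integral_mono Bochner_Integration.integrable_add integrable_mult_right intJ intabs)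
      show "integrable Q (\<lambda>\<omega>. G (W \<omega> - \<xi> i \<omega>))" by (rule int_W_loo[OF i _ G_BG]) auto
      fix \<omega>
      have "2 * a * \<bar>W \<omega> - \<xi> i \<omega>\<bar> \<le> 2 * a * (a + \<bar>W \<omega>\<bar>)"
        using bdd[OF i, of \<omega>] a_pos by (intro mult_left_mono) auto
      moreover have "indicator {c..c + 3 * a} (W \<omega> - \<xi> i \<omega>) \<le> ?J c (W \<omega>)" for c
        using bdd[OF i, of \<omega>] by (auto split: split_indicator)
      note this[of c] this[of d]
      ultimately show "G (W \<omega> - \<xi> i \<omega>) \<le> (3 * a + 2 * a * a) + 2 * a * \<bar>W \<omega>\<bar> + ?J c (W \<omega>) + ?J d (W \<omega>)"
        unfolding G_def by (simp add: algebra_simps)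
    qed auto
    also have "\<dots> = (3 * a + 2 * a * a) + 2 * a * expectation (\<lambda>\<omega>. \<bar>W \<omega>\<bar>)
        + expectation (\<lambda>\<omega>. ?J c (W \<omega>)) + expectation (\<lambda>\<omega>. ?J d (W \<omega>))"
      using intJ intabs by (simp add: prob_space)
    also have "\<dots> \<le> (3 * a + 2 * a * a) + 2 * a * 1 + (5 * a / 2 + 2 * a) + (5 * a / 2 + 2 * a)"
      using concentration[of "c - a" "c + 4 * a"] concentration[of "d - a" "d + 4 * a"] a_pos expectation_abs_W
      by (intro add_mono mult_left_mono) auto
    also have "\<dots> \<le> 16 * a" using a1 a_pos by (simp add: algebra_simps)
    finally show ?thesis .
  qed
  have intF: "integrable Q (\<lambda>\<omega>. F (W \<omega>))" by (rule int_W[where B=2]) (use F2 in auto)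
  have intWf: "integrable Q (\<lambda>\<omega>. W \<omega> * f (W \<omega>))"
    by (rule int_W[where g="\<lambda>x. x * f x" and B="W_max * 3"])
       (use f3 in \<open>auto simp: abs_mult intro!: mult_mono\<close>)
  have inth: "integrable Q (\<lambda>\<omega>. h (W \<omega>))" by (rule int_W[where B=1]) (use h01 in auto)
  have intFi: "integrable Q (\<lambda>\<omega>. F (W \<omega> - \<xi> i \<omega>))" "integrable Q (\<lambda>\<omega>. G (W \<omega> - \<xi> i \<omega>))" if "i \<in> I" for i
    by (rule int_W_loo[OF that, of _ 2], use F2 in \<open>auto intro!: int_W_loo[OF that _ G_BG]\<close>)+
  have "expectation (\<lambda>\<omega>. h (W \<omega>)) - N = expectation (\<lambda>\<omega>. F (W \<omega>)) - expectation (\<lambda>\<omega>. W \<omega> * f (W \<omega>))"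
    unfolding F_def using intWf inth by (simp add: prob_space)
  also have "expectation (\<lambda>\<omega>. F (W \<omega>)) = (\<Sum>i\<in>I. v i * expectation (\<lambda>\<omega>. F (W \<omega>)))"
    by (simp add: sum_v flip: sum_distrib_right)
  also have "\<dots> \<le> (\<Sum>i\<in>I. v i * expectation (\<lambda>\<omega>. F (W \<omega> - \<xi> i \<omega>) + G (W \<omega> - \<xi> i \<omega>)))"
  proof (intro sum_mono mult_left_mono integral_mono v_nonneg intF Bochner_Integration.integrable_add intFi)
    fix i \<omega> assume i: "i \<in> I"
    show "F (W \<omega>) \<le> F (W \<omega> - \<xi> i \<omega>) + G (W \<omega> - \<xi> i \<omega>)"
      using FG[of "W \<omega>" "W \<omega> - \<xi> i \<omega>"] bdd[OF i, of \<omega>] by auto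
  qed
  finally have upper: "expectation (\<lambda>\<omega>. h (W \<omega>)) - N
     \<le> (\<Sum>i\<in>I. v i * expectation (\<lambda>\<omega>. F (W \<omega> - \<xi> i \<omega>) + G (W \<omega> - \<xi> i \<omega>)))
      - expectation (\<lambda>\<omega>. W \<omega> * f (W \<omega>))" by simp
  have lower: "(\<Sum>i\<in>I. v i * expectation (\<lambda>\<omega>. F (W \<omega> - \<xi> i \<omega>) - G (W \<omega> - \<xi> i \<omega>)))
      \<le> expectation (\<lambda>\<omega>. W \<omega> * f (W \<omega>))"
  proof (rule expectation_W_mult_ge[where g="\<lambda>x. F x - G x" and B=3 and B'="2 + BG"])
    fix x z :: real assume z: "\<bar>z\<bar> \<le> a"
    show "z\<^sup>2 * (F x - G x) \<le> z * (f (x + z) - f x)"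
    proof (cases "z = 0")
      case False
      obtain \<eta> where \<eta>: "\<bar>\<eta> - x\<bar> \<le> a" "f (x + z) - f x = z * F \<eta>"
      proof (cases "z > 0")
        case True
        then obtain \<eta> where "x < \<eta>" "\<eta> < x + z" "f (x + z) - f x = (x + z - x) * F \<eta>"
          using MVT2[of x "x + z" f F] f' unfolding F_def by auto
        then show ?thesis using z that[of \<eta>] by auto
      next
        case neg: False
        then obtain \<eta> where "x + z < \<eta>" "\<eta> < x" "f x - f (x + z) = (x - (x + z)) * F \<eta>"
          using MVT2[of "x + z" x f F] f' False unfolding F_def by auto
        then show ?thesis using z that[of \<eta>] by auto
      qed
      have "z\<^sup>2 * (F x - G x) \<le> z\<^sup>2 * F \<eta>"
        using FG[OF \<eta>(1)] by (intro mult_left_mono) auto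
      then show ?thesis using \<eta>(2) by (simp add: power2_eq_square)
    qed simp
  qed (use f3 FG_B in auto)
  from upper lower have "expectation (\<lambda>\<omega>. h (W \<omega>)) - N
     \<le> (\<Sum>i\<in>I. v i * expectation (\<lambda>\<omega>. F (W \<omega> - \<xi> i \<omega>) + G (W \<omega> - \<xi> i \<omega>)))
      - (\<Sum>i\<in>I. v i * expectation (\<lambda>\<omega>. F (W \<omega> - \<xi> i \<omega>) - G (W \<omega> - \<xi> i \<omega>)))"
    by linarith
  also have "\<dots> = (\<Sum>i\<in>I. v i * (2 * expectation (\<lambda>\<omega>. G (W \<omega> - \<xi> i \<omega>))))"
    using intFi by (simp add: algebra_simps flip: sum_subtractf)
  also have "\<dots> \<le> (\<Sum>i\<in>I. v i * (32 * a))"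
    using EG v_nonneg by (intro sum_mono mult_left_mono) auto
  also have "\<dots> = 32 * a" by (simp add: sum_v flip: sum_distrib_right)
  finally show ?thesis by (simp add: N_def)
qed

text \<open>
  Majorise the indicator of \<open>{0..x}\<close> by a trapezoid with ramps of width \<open>a\<close>; under the normal law the two ramps
  have mass at most \<open>2 * a\<close>. For \<open>a > 1\<close> the claim is trivial.
\<close>
lemma interval_bound:
  assumes x: "x \<ge> 0"
  shows "prob {\<omega>\<in>space Q. 0 \<le> W \<omega> \<and> W \<omega> \<le> x}
    \<le> measure (density lborel std_normal_density) {0..x} + 34 * a"
proof (cases "a \<le> 1")
  case False
  have "prob {\<omega>\<in>space Q. 0 \<le> W \<omega> \<and> W \<omega> \<le> x} \<le> 1" by simp
  then show ?thesis using False measure_nonneg[of "density lborel std_normal_density" "{0..x}"] by linarith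
next
  case True
  define h where "h = (\<lambda>y. max 0 (min 1 (min (1 + y / a) (1 + (x - y) / a))))"
  have cont: "continuous_on UNIV h" unfolding h_def by (intro continuous_intros) (use a_pos in auto)
  have h01: "0 \<le> h y" "h y \<le> 1" for y by (auto simp: h_def)
  have h1: "h y = 1" if "0 \<le> y" "y \<le> x" for y
    using that a_pos by (auto simp: h_def min_def)
  have h0: "h y = 0" if "y \<le> - a \<or> y \<ge> x + a" for y
  proof -
    have "1 + y / a \<le> 0 \<or> 1 + (x - y) / a \<le> 0" using that a_pos by (auto simp: field_simps)
    then show ?thesis by (auto simp: h_def)
  qed
  note [measurable] = borel_measurable_continuous_onI[OF cont]
  have var: "\<bar>h z - h y\<bar> \<le> indicator {-2*a..-2*a + 3 * a} y + indicator {x - a..x - a + 3 * a} y"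
    if "\<bar>z - y\<bar> \<le> a" for y z
  proof -
    consider "y \<in> {-2*a..-2*a + 3 * a}" | "y \<in> {x - a..x - a + 3 * a}" | "y < - 2 * a" | "y > x + 2 * a" | "a < y" "y < x - a"
      by (simp add: not_le) linarith
    then show ?thesis
    proof cases
      case 3
      then show ?thesis using that a_pos h0[of y] h0[of z] by (auto simp: abs_le_iff)
    next
      case 4
      then show ?thesis using that a_pos h0[of y] h0[of z] by (auto simp: abs_le_iff)
    next
      case 5
      then show ?thesis using that a_pos h1[of y] h1[of z] by auto
    qed (use h01[of y] h01[of z] in \<open>auto split: split_indicator\<close>)
  qed
  have intn: "integrable lborel (\<lambda>u. indicator {b..c} u * std_normal_density u)" for b c :: real
    by (rule integrable_normal_mult[where B=1]) (auto split: split_indicator)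
  have phi1: "std_normal_density u \<le> 1" for u
    using std_normal_density_le[of u] sqrt_2pi_bounds(1) mult_right_mono[of 1 "sqrt (2*pi)" "std_normal_density u"]
    by (simp add: normal_density_nonneg del: real_sqrt_mult)
  have short: "(LINT u|lborel. indicator {b..b + a} u * std_normal_density u) \<le> a" for b
  proof -
    have "(LINT u|lborel. indicator {b..b + a} u * std_normal_density u) \<le> (LINT u|lborel. indicator {b..b + a} u)"
      using phi1 by (intro integral_mono intn integrable_real_indicator) (auto simp: emeasure_lborel_Icc_eq split: split_indicator)
    also have "\<dots> = a" using a_pos by simp
    finally show ?thesis .
  qed
  have "prob {\<omega>\<in>space Q. 0 \<le> W \<omega> \<and> W \<omega> \<le> x} = expectation (\<lambda>\<omega>. indicator {\<omega>\<in>space Q. 0 \<le> W \<omega> \<and> W \<omega> \<le> x} \<omega>)"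
    by simp
  also have "\<dots> \<le> expectation (\<lambda>\<omega>. h (W \<omega>))"
  proof (intro integral_mono)
    show "integrable Q (\<lambda>\<omega>. h (W \<omega>))" by (rule int_W[where B=1]) (use h01 in auto)
  qed (use h1 h01 in \<open>auto split: split_indicator simp: less_top[symmetric]\<close>)
  also have "\<dots> \<le> (LINT u|lborel. h u * std_normal_density u) + 32 * a"
    by (rule stein_bound[OF cont h01 var True])
  also have "(LINT u|lborel. h u * std_normal_density u) \<le>
    (LINT u|lborel. indicator {0..x} u * std_normal_density u + indicator {-a..-a+a} u * std_normal_density u
        + indicator {x..x+a} u * std_normal_density u)"
  proof (intro integral_mono Bochner_Integration.integrable_add intn)
    show "integrable lborel (\<lambda>u. h u * std_normal_density u)"
      by (rule integrable_normal_mult[where B=1]) (use h01 in auto)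
    fix u
    have "h u \<le> indicator {0..x} u + indicator {-a..-a+a} u + indicator {x..x+a} u"
      using h0[of u] h01[of u] by (auto split: split_indicator)
    from mult_right_mono[OF this, of "std_normal_density u"]
    show "h u * std_normal_density u \<le> indicator {0..x} u * std_normal_density u + indicator {-a..-a+a} u * std_normal_density u
        + indicator {x..x+a} u * std_normal_density u"
      by (simp add: normal_density_nonneg distrib_right)
  qed
  also have "\<dots> = (LINT u|lborel. indicator {0..x} u * std_normal_density u)
      + (LINT u|lborel. indicator {-a..-a+a} u * std_normal_density u) + (LINT u|lborel. indicator {x..x+a} u * std_normal_density u)"
    using intn by (subst Bochner_Integration.integral_add, (intro Bochner_Integration.integrable_add)?, simp_all)+
  also have "\<dots> \<le> (LINT u|lborel. indicator {0..x} u * std_normal_density u) + a + a"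
    by (intro add_mono order_refl short)
  also have "(LINT u|lborel. indicator {0..x} u * std_normal_density u) = measure (density lborel std_normal_density) {0..x}"
  proof -
    have "(LINT u|lborel. std_normal_density u *\<^sub>R (indicator {0..x} u :: real)) = (LINT u|density lborel std_normal_density. indicator {0..x} u)"
      by (rule integral_density[symmetric]) (auto simp: normal_density_nonneg)
    then show ?thesis by (simp add: mult.commute)
  qed
  finally show ?thesis by simp
qed

end


section \<open>Laplace transforms on the half line\<close>

text \<open>
  For \<open>y \<ge> 0\<close> the number \<open>exp (- l * y)\<close> is the mass that the exponential law gives to \<open>{y..}\<close>; exchange the
  integrals. This writes the Laplace transform on the half line as a mixture of interval probabilities.
\<close>
lemma laplace_layer_cake:
  fixes l :: real and Y :: "'b \<Rightarrow> real"
  assumes M: "sigma_finite_measure M" and [measurable]: "Y \<in> borel_measurable M" and l: "l > 0"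
  shows "(\<integral>\<^sup>+\<omega>. ennreal (indicator {0..} (Y \<omega>) * exp (- (l * Y \<omega>))) \<partial>M)
    = (\<integral>\<^sup>+x. ennreal (erlang_density 0 l x) * emeasure M {\<omega>\<in>space M. 0 \<le> Y \<omega> \<and> Y \<omega> \<le> x} \<partial>lborel)"
proof -
  interpret M: sigma_finite_measure M by fact
  interpret pair_sigma_finite M lborel ..
  have inner: "ennreal (indicator {0..} y * exp (- (l * y)))
      = (\<integral>\<^sup>+x. ennreal (erlang_density 0 l x) * indicator {y..} x * indicator {0..} y \<partial>lborel)" for y
  proof (cases "y \<ge> 0")
    case True
    have "(\<integral>\<^sup>+x. ennreal (erlang_density 0 l x) * indicator {y..} x \<partial>lborel)
        = (\<integral>\<^sup>+x. ennreal (erlang_density 0 l (y + x)) * indicator {y..} (y + x) \<partial>lborel)"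
      by (subst nn_integral_real_affine[where c=1 and t=y]) auto
    also have "\<dots> = (\<integral>\<^sup>+x. ennreal (exp (- (l * y))) * ennreal (erlang_density 0 l x) \<partial>lborel)"
      using True l by (intro nn_integral_cong)
        (auto simp: erlang_density_def ennreal_mult[symmetric] mult_exp_exp algebra_simps split: split_indicator)
    also have "\<dots> = ennreal (exp (- (l * y))) * (\<integral>\<^sup>+x. ennreal (erlang_density 0 l x) \<partial>lborel)"
      by (rule nn_integral_cmult) auto
    also have "(\<integral>\<^sup>+x. ennreal (erlang_density 0 l x) \<partial>lborel) = 1"
      using nn_integral_erlang_ith_moment[OF l, of 0 0] by simp
    finally show ?thesis using True by simp
  qed simp
  have "(\<integral>\<^sup>+\<omega>. ennreal (indicator {0..} (Y \<omega>) * exp (- (l * Y \<omega>))) \<partial>M)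
      = (\<integral>\<^sup>+\<omega>. (\<integral>\<^sup>+x. ennreal (erlang_density 0 l x) * indicator {Y \<omega>..} x * indicator {0..} (Y \<omega>) \<partial>lborel) \<partial>M)"
    by (simp add: inner)
  also have "\<dots> = (\<integral>\<^sup>+x. (\<integral>\<^sup>+\<omega>. ennreal (erlang_density 0 l x) * indicator {Y \<omega>..} x * indicator {0..} (Y \<omega>) \<partial>M) \<partial>lborel)"
  proof (rule Fubini'[symmetric])
    have "(\<lambda>z. ennreal (erlang_density 0 l (snd z)) * indicator {z \<in> space (M \<Otimes>\<^sub>M lborel). Y (fst z) \<le> snd z} z * indicator {0..} (Y (fst z)))
        \<in> borel_measurable (M \<Otimes>\<^sub>M lborel)"
      by measurable
    also have "?this \<longleftrightarrow> (\<lambda>(\<omega>, x). ennreal (erlang_density 0 l x) * indicator {Y \<omega>..} x * indicator {0..} (Y \<omega>))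
        \<in> borel_measurable (M \<Otimes>\<^sub>M lborel)"
      by (intro measurable_cong) (auto split: split_indicator)
    finally show "(\<lambda>(\<omega>, x). ennreal (erlang_density 0 l x) * indicator {Y \<omega>..} x * indicator {0..} (Y \<omega>))
        \<in> borel_measurable (M \<Otimes>\<^sub>M lborel)" .
  qed
  also have "\<dots> = (\<integral>\<^sup>+x. ennreal (erlang_density 0 l x) * emeasure M {\<omega>\<in>space M. 0 \<le> Y \<omega> \<and> Y \<omega> \<le> x} \<partial>lborel)"
  proof (rule nn_integral_cong)
    fix x
    have "(\<integral>\<^sup>+\<omega>. ennreal (erlang_density 0 l x) * indicator {Y \<omega>..} x * indicator {0..} (Y \<omega>) \<partial>M)
        = (\<integral>\<^sup>+\<omega>. ennreal (erlang_density 0 l x) * indicator {\<omega>\<in>space M. 0 \<le> Y \<omega> \<and> Y \<omega> \<le> x} \<omega> \<partial>M)"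
      by (intro nn_integral_cong) (auto split: split_indicator)
    also have "\<dots> = ennreal (erlang_density 0 l x) * emeasure M {\<omega>\<in>space M. 0 \<le> Y \<omega> \<and> Y \<omega> \<le> x}"
      by (rule nn_integral_cmult_indicator) measurable
    finally show "(\<integral>\<^sup>+\<omega>. ennreal (erlang_density 0 l x) * indicator {Y \<omega>..} x * indicator {0..} (Y \<omega>) \<partial>M)
        = ennreal (erlang_density 0 l x) * emeasure M {\<omega>\<in>space M. 0 \<le> Y \<omega> \<and> Y \<omega> \<le> x}" .
  qed
  finally show ?thesis .
qed

lemma (in leave_one_out) laplace_bound:
  assumes l: "l > 0"
  shows "expectation (\<lambda>\<omega>. indicator {0..} (W \<omega>) * exp (- (l * W \<omega>))) \<le> \<theta> l + 34 * a"
proof -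
  let ?N = "density lborel std_normal_density"
  interpret N: prob_space ?N by (rule prob_space_normal_density) simp
  have "ennreal (expectation (\<lambda>\<omega>. indicator {0..} (W \<omega>) * exp (- (l * W \<omega>))))
      = (\<integral>\<^sup>+\<omega>. ennreal (indicator {0..} (W \<omega>) * exp (- (l * W \<omega>))) \<partial>Q)"
  proof (rule nn_integral_eq_integral[symmetric])
    show "integrable Q (\<lambda>\<omega>. indicator {0..} (W \<omega>) * exp (- (l * W \<omega>)))"
      using l by (intro int_bounded[where B=1]) (auto split: split_indicator)
  qed auto
  also have "\<dots> = (\<integral>\<^sup>+x. ennreal (erlang_density 0 l x) * emeasure Q {\<omega>\<in>space Q. 0 \<le> W \<omega> \<and> W \<omega> \<le> x} \<partial>lborel)"
    by (rule laplace_layer_cake[OF sigma_finite_measure_axioms W_meas l])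
  also have "\<dots> \<le> (\<integral>\<^sup>+x. ennreal (erlang_density 0 l x) * emeasure ?N {\<omega>\<in>space ?N. 0 \<le> \<omega> \<and> \<omega> \<le> x}
      + ennreal (34 * a) * ennreal (erlang_density 0 l x) \<partial>lborel)"
  proof (intro nn_integral_mono)
    fix x :: real
    show "ennreal (erlang_density 0 l x) * emeasure Q {\<omega>\<in>space Q. 0 \<le> W \<omega> \<and> W \<omega> \<le> x}
      \<le> ennreal (erlang_density 0 l x) * emeasure ?N {\<omega>\<in>space ?N. 0 \<le> \<omega> \<and> \<omega> \<le> x}
        + ennreal (34 * a) * ennreal (erlang_density 0 l x)"
    proof (cases "x \<ge> 0")
      case True
      have eq: "{\<omega>\<in>space ?N. 0 \<le> \<omega> \<and> \<omega> \<le> x} = {0..x}" by auto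
      have "ennreal (prob {\<omega>\<in>space Q. 0 \<le> W \<omega> \<and> W \<omega> \<le> x}) \<le> ennreal (measure ?N {0..x} + 34 * a)"
        by (intro ennreal_leI interval_bound True)
      then have "emeasure Q {\<omega>\<in>space Q. 0 \<le> W \<omega> \<and> W \<omega> \<le> x} \<le> emeasure ?N {0..x} + ennreal (34 * a)"
        using a_pos by (simp add: emeasure_eq_measure N.emeasure_eq_measure)
      then have "ennreal (erlang_density 0 l x) * emeasure Q {\<omega>\<in>space Q. 0 \<le> W \<omega> \<and> W \<omega> \<le> x}
          \<le> ennreal (erlang_density 0 l x) * (emeasure ?N {0..x} + ennreal (34 * a))"
        by (rule mult_left_mono) simp
      then show ?thesis unfolding eq by (simp add: distrib_left mult.commute)
    qed (simp add: erlang_density_def)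
  qed
  also have "\<dots> = (\<integral>\<^sup>+x. ennreal (erlang_density 0 l x) * emeasure ?N {\<omega>\<in>space ?N. 0 \<le> \<omega> \<and> \<omega> \<le> x} \<partial>lborel)
      + (\<integral>\<^sup>+x. ennreal (34 * a) * ennreal (erlang_density 0 l x) \<partial>lborel)"
  proof (rule nn_integral_add)
    have "(\<lambda>x. measure ?N {\<omega>\<in>space ?N. 0 \<le> \<omega> \<and> \<omega> \<le> x}) \<in> borel_measurable borel"
      by (rule borel_measurable_mono) (auto simp: mono_def intro!: N.finite_measure_mono)
    then show "(\<lambda>x. ennreal (erlang_density 0 l x) * emeasure ?N {\<omega>\<in>space ?N. 0 \<le> \<omega> \<and> \<omega> \<le> x}) \<in> borel_measurable lborel"
      by (simp add: N.emeasure_eq_measure)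
  qed simp
  also have "(\<integral>\<^sup>+x. ennreal (34 * a) * ennreal (erlang_density 0 l x) \<partial>lborel) = ennreal (34 * a)"
    using nn_integral_erlang_ith_moment[OF l, of 0 0] by (subst nn_integral_cmult) auto
  also have "(\<integral>\<^sup>+x. ennreal (erlang_density 0 l x) * emeasure ?N {\<omega>\<in>space ?N. 0 \<le> \<omega> \<and> \<omega> \<le> x} \<partial>lborel)
      = (\<integral>\<^sup>+u. ennreal (indicator {0..} u * exp (- (l * u))) \<partial>?N)"
    by (rule laplace_layer_cake[symmetric, where Y="\<lambda>u. u", OF N.sigma_finite_measure_axioms _ l]) simp
  also have "\<dots> = (\<integral>\<^sup>+u. ennreal (indicator {0..} u * exp (- (l * u)) * std_normal_density u) \<partial>lborel)"
    by (subst nn_integral_density) (auto intro!: nn_integral_cong simp: normal_density_nonneg ennreal_mult'' mult.commute)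
  also have "\<dots> = ennreal (\<theta> l)"
    unfolding theta_eq_laplace using l
    by (intro nn_integral_eq_integral integrable_theta_laplace) (auto simp: normal_density_nonneg)
  finally show ?thesis
    using theta_nonneg[of l] a_pos by (simp flip: ennreal_plus)
qed


section \<open>Exponential generating functions and truncated moments\<close>

text \<open>
  Exponential generating functions of moment sequences are moment generating functions, and replacing
  moments becomes replacing coefficients.
\<close>
definition egf :: "(nat \<Rightarrow> real) \<Rightarrow> real \<Rightarrow> real" where
  "egf c y = (\<Sum>k. c k / fact k * y ^ k)"

definition egf_entire :: "(nat \<Rightarrow> real) \<Rightarrow> bool" where
  "egf_entire c \<longleftrightarrow> (\<forall>y. summable (\<lambda>k. c k / fact k * y ^ k))"

lemma egf_sums: "egf_entire c \<Longrightarrow> (\<lambda>k. c k / fact k * y ^ k) sums egf c y"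
  unfolding egf_def egf_entire_def by (auto intro: summable_sums)

lemma egf_entireI:
  assumes "\<And>k. \<bar>c k\<bar> \<le> A * B ^ k"
  shows "egf_entire c"
  unfolding egf_entire_def
proof
  fix y
  have "summable (\<lambda>k. A * (inverse (fact k) * (B * \<bar>y\<bar>) ^ k))"
    by (intro summable_mult summable_exp)
  then show "summable (\<lambda>k. c k / fact k * y ^ k)"
  proof (rule summable_comparison_test'[where N=0])
    fix k
    have "\<bar>c k\<bar> * \<bar>y\<bar> ^ k \<le> A * B ^ k * \<bar>y\<bar> ^ k"
      using assms[of k] by (intro mult_right_mono) auto
    then show "norm (c k / fact k * y ^ k) \<le> A * (inverse (fact k) * (B * \<bar>y\<bar>) ^ k)"
      by (simp add: abs_mult power_abs field_simps divide_right_mono power_mult_distrib)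
  qed
qed

lemma egf_entire_diffs:
  "diffs (\<lambda>k. c k / fact k) = (\<lambda>k. c (Suc k) / fact k :: real)"
  by (simp add: diffs_def fun_eq_iff del: of_nat_Suc)

lemma egf_entire_shift:
  assumes "egf_entire c"
  shows "egf_entire (\<lambda>k. c (Suc k))"
  using termdiff_converges_all[of "\<lambda>k. c k / fact k"] assms
  unfolding egf_entire_def egf_entire_diffs by blast

lemma DERIV_egf:
  assumes "egf_entire c"
  shows "(egf c has_real_derivative egf (\<lambda>k. c (Suc k)) y) (at y)"
  using termdiffs_strong_converges_everywhere[of "\<lambda>k. c k / fact k" y] assms
  unfolding egf_entire_def egf_entire_diffs egf_def[abs_def] by blast

lemma egf_0: "egf c 0 = c 0"
proof -
  have "(\<Sum>k. c k / fact k * 0 ^ k) = c 0 / fact 0"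
    by (rule powser_zero)
  then show ?thesis by (simp add: egf_def)
qed

lemma egf_pos:
  assumes "egf_entire c" "\<And>k. c k > 0" "y \<ge> 0"
  shows "egf c y > 0"
proof -
  have "0 < (\<Sum>k. c k / fact k * y ^ k)"
    using assms less_imp_le[OF assms(2)]
    by (intro suminf_pos2[where i=0]) (auto simp: egf_entire_def)
  then show ?thesis by (simp add: egf_def)
qed

lemma egf_index_sums:
  assumes "egf_entire c"
  shows "(\<lambda>k. real k * (c k / fact k * y ^ k)) sums (y * egf (\<lambda>k. c (Suc k)) y)"
proof -
  let ?f = "\<lambda>k. real k * (c k / fact k * y ^ k)"
  have "(\<lambda>k. y * (c (Suc k) / fact k * y ^ k)) sums (y * egf (\<lambda>k. c (Suc k)) y)"
    by (intro sums_mult egf_sums egf_entire_shift assms)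
  also have "(\<lambda>k. y * (c (Suc k) / fact k * y ^ k)) = (\<lambda>k. ?f (Suc k))"
    by (simp add: fun_eq_iff mult_ac del: of_nat_Suc)
  finally show ?thesis
    by (subst (asm) sums_Suc_iff) simp
qed

text \<open>
  A series whose coefficients grow faster has the larger logarithmic derivative. With weights
  \<open>c k * y ^ k / fact k\<close>, the value \<open>y\<close> times the logarithmic derivative of \<open>egf c\<close> is the mean \<open>m\<close> of the
  index \<open>k\<close>, and the claim is Chebyshev's association inequality for the increasing functions \<open>k\<close> and
  \<open>d k / c k\<close>. It follows by summing \<open>(k - m) * (d k / c k - r) \<ge> 0\<close>, where \<open>r\<close> is the value of \<open>d k / c k\<close>
  at the integer part of \<open>m\<close>.
\<close>
lemma egf_log_deriv_mono_coeff:
  assumes c: "egf_entire c" "\<And>k. c k > 0" and d: "egf_entire d"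
    and mono: "mono (\<lambda>k. d k / c k)" and y: "y \<ge> 0"
  shows "egf (\<lambda>k. c (Suc k)) y * egf d y \<le> egf (\<lambda>k. d (Suc k)) y * egf c y"
proof (cases "y = 0")
  case True
  have "d 0 / c 0 \<le> d (Suc 0) / c (Suc 0)" using mono by (auto simp: mono_def)
  then show ?thesis using True c(2)[of 0] c(2)[of "Suc 0"] by (simp add: egf_0 field_simps)
next
  case False
  then have y: "y > 0" using y by simp
  let ?c' = "egf (\<lambda>k. c (Suc k)) y" and ?d' = "egf (\<lambda>k. d (Suc k)) y"
  have pos: "egf c y > 0" "?c' > 0"
    using c y by (auto intro!: egf_pos egf_entire_shift)
  define m where "m = y * ?c' / egf c y"
  have m: "m \<ge> 0" using pos y by (simp add: m_def)
  define r where "r = d (nat \<lfloor>m\<rfloor>) / c (nat \<lfloor>m\<rfloor>)"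
  let ?T = "\<lambda>k. (real k * (d k / fact k * y ^ k) - r * (real k * (c k / fact k * y ^ k)))
      - m * (d k / fact k * y ^ k - r * (c k / fact k * y ^ k))"
  have "?T sums ((y * ?d' - r * (y * ?c')) - m * (egf d y - r * egf c y))"
    by (intro sums_diff sums_mult egf_index_sums egf_sums c d)
  moreover have "?T k \<ge> 0" for k
  proof -
    have "?T k = (real k - m) * (d k / c k - r) * (c k / fact k * y ^ k)"
      using c(2)[of k] by (simp add: field_simps)
    moreover have "(real k - m) * (d k / c k - r) \<ge> 0"
    proof (cases "real k \<ge> m")
      case True
      then have "nat \<lfloor>m\<rfloor> \<le> k" using m by linarith
      then have "r \<le> d k / c k" using mono unfolding r_def mono_def by blast
      then show ?thesis using True by simp
    next
      case False
      then have "k \<le> nat \<lfloor>m\<rfloor>" by linarith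
      then have "d k / c k \<le> r" using mono unfolding r_def mono_def by blast
      then show ?thesis using False by (simp add: mult_nonpos_nonpos)
    qed
    ultimately show ?thesis using c(2)[of k] y by simp
  qed
  ultimately have "0 \<le> (y * ?d' - r * (y * ?c')) - m * (egf d y - r * egf c y)"
    by (rule sums_le[OF _ sums_zero, rotated])
  also have "\<dots> = y * ?d' - m * egf d y" using pos by (simp add: m_def field_simps)
  also have "\<dots> = y * (?d' * egf c y - ?c' * egf d y) / egf c y"
    using pos by (simp add: m_def field_simps)
  finally show ?thesis
    using y pos by (simp add: zero_le_divide_iff zero_le_mult_iff)
qed

lemma egf_eventually_const:
  assumes "\<And>k. k \<ge> m \<Longrightarrow> d k = D"
  shows "egf d y = D * exp y + (\<Sum>k<m. y ^ k / fact k * (d k - D))"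
proof -
  have "(\<lambda>k. D * (y ^ k /\<^sub>R fact k) + y ^ k / fact k * (d k - D)) sums
      (D * exp y + (\<Sum>k<m. y ^ k / fact k * (d k - D)))"
    by (intro sums_add sums_mult exp_converges sums_finite) (use assms in auto)
  also have "(\<lambda>k. D * (y ^ k /\<^sub>R fact k) + y ^ k / fact k * (d k - D)) = (\<lambda>k. d k / fact k * y ^ k)"
    by (simp add: fun_eq_iff field_simps)
  finally show ?thesis by (simp add: egf_def sums_iff)
qed

text \<open>
  For moments \<open>e k\<close> of a variable with values in \<open>[0, 1]\<close>, every moment beyond the \<open>p\<close>-th is replaced by the
  \<open>p\<close>-th, its best upper bound. Through the shift by one the untruncated
  sequence is, up to a constant factor, that of the moments of the size-biased law.
\<close>
definition truncated_moments :: "nat \<Rightarrow> (nat \<Rightarrow> real) \<Rightarrow> nat \<Rightarrow> real" where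
  "truncated_moments p e k = e (min (Suc k) p)"

text \<open>
  The definition of \<open>C\<close> is a closed form of a logarithmic derivative: the generating function of an eventually constant sequence
  is that constant times \<open>exp\<close> plus finitely many corrections. Numerator and denominator carry the common factor \<open>\<beta> ^ p\<close>.
\<close>
lemma C_eq_egf:
  assumes "p \<ge> 1" "\<beta> > 0" and e: "\<And>k. e k = \<mu> k / \<beta> ^ k"
  defines "d \<equiv> truncated_moments p e"
  shows "C p y \<beta> \<mu> = (egf (\<lambda>k. d (Suc k)) y / egf d y)\<^sup>2"
proof -
  have "egf d y = e p * exp y + (\<Sum>k<p - 1. y ^ k / fact k * (d k - e p))"
    by (rule egf_eventually_const) (use \<open>p \<ge> 1\<close> in \<open>auto simp: d_def truncated_moments_def min_def intro!: arg_cong[where f=e]\<close>)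
  then have "\<beta> ^ p * egf d y = \<mu> p * exp y + (\<Sum>k<p - 1. y ^ k / fact k * (\<beta> ^ p * (d k - e p)))"
    using assms by (simp add: distrib_left sum_distrib_left mult_ac)
  also have "(\<Sum>k<p - 1. y ^ k / fact k * (\<beta> ^ p * (d k - e p)))
      = (\<Sum>j<p - 1. y ^ j / fact j * (\<beta> ^ (p - j - 1) * \<mu> (j + 1) - \<mu> p))"
  proof (intro sum.cong refl arg_cong2[where f="(*)"])
    fix k assume "k \<in> {..<p - 1}"
    then have "p = (p - k - 1) + Suc k" by auto
    then have "\<beta> ^ p = \<beta> ^ (p - k - 1) * \<beta> ^ Suc k" by (metis power_add)
    moreover have "min (Suc k) p = Suc k" using \<open>k \<in> _\<close> by auto
    ultimately show "\<beta> ^ p * (d k - e p) = \<beta> ^ (p - k - 1) * \<mu> (k + 1) - \<mu> p"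
      using \<open>\<beta> > 0\<close> by (simp add: d_def truncated_moments_def e right_diff_distrib)
  qed
  finally have D: "\<beta> ^ p * egf d y = \<mu> p * exp y + (\<Sum>j<p - 1. y ^ j / fact j * (\<beta> ^ (p - j - 1) * \<mu> (j + 1) - \<mu> p))" .
  have "egf (\<lambda>k. d (Suc k)) y = e p * exp y + (\<Sum>k<p - 2. y ^ k / fact k * (d (Suc k) - e p))"
    by (rule egf_eventually_const) (use \<open>p \<ge> 1\<close> in \<open>auto simp: d_def truncated_moments_def min_def intro!: arg_cong[where f=e]\<close>)
  then have "\<beta> ^ p * egf (\<lambda>k. d (Suc k)) y = \<mu> p * exp y + (\<Sum>k<p - 2. y ^ k / fact k * (\<beta> ^ p * (d (Suc k) - e p)))"
    using assms by (simp add: distrib_left sum_distrib_left mult_ac)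
  also have "(\<Sum>k<p - 2. y ^ k / fact k * (\<beta> ^ p * (d (Suc k) - e p)))
      = (\<Sum>j<p - 2. y ^ j / fact j * (\<beta> ^ (p - j - 2) * \<mu> (j + 2) - \<mu> p))"
  proof (intro sum.cong refl arg_cong2[where f="(*)"])
    fix k assume "k \<in> {..<p - 2}"
    then have "p = (p - k - 2) + (k + 2)" by auto
    then have "\<beta> ^ p = \<beta> ^ (p - k - 2) * \<beta> ^ (k + 2)" by (metis power_add)
    moreover have "min (Suc (Suc k)) p = Suc (Suc k)" using \<open>k \<in> _\<close> by auto
    ultimately show "\<beta> ^ p * (d (Suc k) - e p) = \<beta> ^ (p - k - 2) * \<mu> (k + 2) - \<mu> p"
      using \<open>\<beta> > 0\<close> by (simp add: d_def truncated_moments_def e right_diff_distrib)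
  qed
  finally have N: "\<beta> ^ p * egf (\<lambda>k. d (Suc k)) y = \<mu> p * exp y + (\<Sum>j<p - 2. y ^ j / fact j * (\<beta> ^ (p - j - 2) * \<mu> (j + 2) - \<mu> p))" .
  have "egf (\<lambda>k. d (Suc k)) y / egf d y = (\<beta> ^ p * egf (\<lambda>k. d (Suc k)) y) / (\<beta> ^ p * egf d y)"
    using \<open>\<beta> > 0\<close> by simp
  then show ?thesis unfolding C_def D N by simp
qed

locale moment_sequence =
  fixes e :: "nat \<Rightarrow> real"
  assumes pos: "e k > 0" and antimono: "e (Suc k) \<le> e k"
    and log_convex: "(e (Suc k))\<^sup>2 \<le> e k * e (Suc (Suc k))"
begin

lemma decreasing: "k \<le> l \<Longrightarrow> e l \<le> e k"
  by (rule lift_Suc_antimono_le[where f=e]) (auto intro: antimono)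

lemma egf_entire_e: "egf_entire (\<lambda>k. e (k + j))"
  by (rule egf_entireI[where A="e 0" and B=1]) (use decreasing[of 0] pos in \<open>auto simp: less_imp_le\<close>)

lemma egf_entire_truncated: "egf_entire (truncated_moments p e)"
  by (rule egf_entireI[where A="e 0" and B=1])
     (use decreasing[of 0] pos in \<open>auto simp: less_imp_le truncated_moments_def\<close>)

lemma truncated_pos: "truncated_moments p e k > 0"
  by (simp add: truncated_moments_def pos)

lemma egf_truncated_pos:
  assumes "y \<ge> 0"
  shows "egf (truncated_moments p e) y > 0" "egf (\<lambda>k. truncated_moments p e (Suc k)) y > 0"
  by (auto intro!: egf_pos egf_entire_truncated egf_entire_shift truncated_pos assms)

text \<open>
  The quotient of truncated and true moments is \<open>1\<close> up to the index \<open>p\<close> and increases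
  afterwards, because the moments decrease.
\<close>
lemma log_deriv_le_truncated:
  assumes y: "y \<ge> 0"
  shows "egf (\<lambda>k. e (k + 2)) y / egf (\<lambda>k. e (k + 1)) y
    \<le> egf (\<lambda>k. truncated_moments p e (Suc k)) y / egf (truncated_moments p e) y"
proof -
  have "egf (\<lambda>k. e (Suc k + 1)) y * egf (truncated_moments p e) y
      \<le> egf (\<lambda>k. truncated_moments p e (Suc k)) y * egf (\<lambda>k. e (k + 1)) y"
  proof (rule egf_log_deriv_mono_coeff[where c="\<lambda>k. e (k + 1)"])
    show "mono (\<lambda>k. truncated_moments p e k / e (k + 1))"
    proof (rule mono_iff_le_Suc[THEN iffD2], rule allI)
      fix k
      show "truncated_moments p e k / e (k + 1) \<le> truncated_moments p e (Suc k) / e (Suc k + 1)"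
      proof (cases "Suc (Suc k) \<le> p")
        case True
        then show ?thesis using pos[of "Suc k"] pos[of "Suc (Suc k)"] by (simp add: truncated_moments_def)
      next
        case False
        then have "truncated_moments p e (Suc k) = truncated_moments p e k" by (auto simp: truncated_moments_def min_def intro: arg_cong[where f=e])
        then show ?thesis
          using pos[of "Suc k"] pos[of "Suc (Suc k)"] antimono[of "Suc k"] truncated_pos[of p k]
          by (auto intro!: divide_left_mono simp: less_imp_le)
      qed
    qed
  qed (use egf_entire_e[of 1] in \<open>auto intro: egf_entire_truncated pos y\<close>)
  moreover have "egf (\<lambda>k. e (k + 1)) y > 0"
    by (rule egf_pos[OF egf_entire_e pos y])
  ultimately show ?thesis
    using egf_truncated_pos[OF y, of p] by (simp add: field_simps)
qed

text \<open>
  The derivative of the quotient is nonnegative by \<open>egf_log_deriv_mono_coeff\<close>, applied to the sequence and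
  its own shift: log-convexity of the moments makes successive quotients increase, and
  truncation continues them by \<open>1\<close>, which is not smaller.
\<close>
lemma truncated_log_deriv_mono:
  assumes "0 \<le> y" "y \<le> z"
  shows "egf (\<lambda>k. truncated_moments p e (Suc k)) y / egf (truncated_moments p e) y
    \<le> egf (\<lambda>k. truncated_moments p e (Suc k)) z / egf (truncated_moments p e) z"
proof (rule DERIV_nonneg_imp_nondecreasing[OF assms(2)])
  let ?d = "truncated_moments p e"
  fix x assume "y \<le> x" "x \<le> z"
  with assms have x: "x \<ge> 0" by simp
  let ?D = "(egf (\<lambda>k. ?d (Suc (Suc k))) x * egf ?d x - egf (\<lambda>k. ?d (Suc k)) x * egf (\<lambda>k. ?d (Suc k)) x) / (egf ?d x * egf ?d x)"
  have "((\<lambda>y. egf (\<lambda>k. ?d (Suc k)) y / egf ?d y) has_real_derivative ?D) (at x)"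
    using egf_truncated_pos(1)[OF x, of p]
    by (intro DERIV_divide DERIV_egf egf_entire_truncated egf_entire_shift) auto
  moreover have "egf (\<lambda>k. ?d (Suc k)) x * egf (\<lambda>k. ?d (Suc k)) x \<le> egf (\<lambda>k. ?d (Suc (Suc k))) x * egf ?d x"
  proof (rule egf_log_deriv_mono_coeff[OF _ _ _ _ x])
    show "mono (\<lambda>k. ?d (Suc k) / ?d k)"
    proof (rule mono_iff_le_Suc[THEN iffD2], rule allI)
      fix k
      have "?d (Suc k) * ?d (Suc k) \<le> ?d (Suc (Suc k)) * ?d k"
      proof (cases "Suc (Suc (Suc k)) \<le> p")
        case True
        then show ?thesis using log_convex[of "Suc k"] by (simp add: truncated_moments_def power2_eq_square mult.commute)
      next
        case False
        then have "?d (Suc (Suc k)) = ?d (Suc k)"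
          by (auto simp: truncated_moments_def min_def intro: arg_cong[where f=e])
        moreover have "?d (Suc k) \<le> ?d k"
          by (auto simp: truncated_moments_def intro!: decreasing)
        ultimately show ?thesis using truncated_pos[of p "Suc k"] by (simp add: mult_left_mono)
      qed
      then show "?d (Suc k) / ?d k \<le> ?d (Suc (Suc k)) / ?d (Suc k)"
        using truncated_pos[of p "Suc k"] truncated_pos[of p k] by (simp add: field_simps)
    qed
  qed (auto intro: egf_entire_truncated egf_entire_shift truncated_pos)
  ultimately show "\<exists>D. ((\<lambda>y. egf (\<lambda>k. ?d (Suc k)) y / egf ?d y) has_real_derivative D) (at x) \<and> 0 \<le> D"
    by (intro exI[of _ ?D] conjI divide_nonneg_nonneg) auto
qed

lemma truncated_log_deriv_ge:
  assumes "p \<ge> 1" "0 \<le> y"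
  shows "e 2 / e 1 \<le> egf (\<lambda>k. truncated_moments p e (Suc k)) y / egf (truncated_moments p e) y"
proof -
  have "e 2 / e 1 \<le> egf (\<lambda>k. truncated_moments p e (Suc k)) 0 / egf (truncated_moments p e) 0"
  proof (cases "p = 1")
    case True
    then show ?thesis using pos[of 1] antimono[of 1] by (simp add: egf_0 truncated_moments_def numeral_2_eq_2)
  qed (use assms in \<open>auto simp: egf_0 truncated_moments_def min_def numeral_2_eq_2\<close>)
  also note truncated_log_deriv_mono[OF order_refl assms(2)]
  finally show ?thesis .
qed

end


section \<open>Exponential moments of one bounded variable\<close>

context prob_space
begin

lemma abs_expectation_le:
  fixes f :: "'a \<Rightarrow> real"
  assumes [measurable]: "f \<in> borel_measurable M" and "\<And>\<omega>. \<bar>f \<omega>\<bar> \<le> B"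
  shows "integrable M f" "\<bar>expectation f\<bar> \<le> B"
proof -
  show "integrable M f" using assms by (intro integrable_const_bound[where B=B]) auto
  have "\<bar>expectation f\<bar> \<le> expectation (\<lambda>\<omega>. \<bar>f \<omega>\<bar>)" by (rule integral_abs_bound)
  also have "\<dots> \<le> expectation (\<lambda>_. B)"
    using \<open>integrable M f\<close> assms by (intro integral_mono) auto
  finally show "\<bar>expectation f\<bar> \<le> B" by (simp add: prob_space)
qed

text \<open>
  Integrate the exponential series termwise; this turns derivatives in \<open>u\<close> into shifts of moments.
\<close>
lemma expectation_power_exp:
  fixes Z :: "'a \<Rightarrow> real"
  assumes Z[measurable]: "Z \<in> borel_measurable M" and B: "\<And>\<omega>. \<bar>Z \<omega>\<bar> \<le> B"
  shows "integrable M (\<lambda>\<omega>. Z \<omega> ^ j * exp (u * Z \<omega>))"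
    "egf_entire (\<lambda>k. expectation (\<lambda>\<omega>. Z \<omega> ^ (k + j)))"
    "expectation (\<lambda>\<omega>. Z \<omega> ^ j * exp (u * Z \<omega>)) = egf (\<lambda>k. expectation (\<lambda>\<omega>. Z \<omega> ^ (k + j))) u"
proof -
  have B0: "B \<ge> 0" using B[of undefined] by linarith
  have Zk: "\<bar>Z \<omega> ^ k\<bar> \<le> B ^ k" for k \<omega>
    unfolding power_abs using B by (intro power_mono) auto
  have m: "\<bar>expectation (\<lambda>\<omega>. Z \<omega> ^ k)\<bar> \<le> B ^ k" "integrable M (\<lambda>\<omega>. Z \<omega> ^ k)" for k
    by (rule abs_expectation_le[OF _ Zk]; simp)+
  show entire: "egf_entire (\<lambda>k. expectation (\<lambda>\<omega>. Z \<omega> ^ (k + j)))"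
    by (rule egf_entireI[where A="B ^ j" and B=B]) (use m(1) in \<open>simp add: mult.commute flip: power_add\<close>)
  let ?f = "\<lambda>k \<omega>. Z \<omega> ^ (k + j) / fact k * u ^ k"
  have entire': "egf_entire (\<lambda>k. \<bar>z\<bar> ^ (k + j))" for z :: real
    by (rule egf_entireI[where A="\<bar>z\<bar> ^ j" and B="\<bar>z\<bar>"]) (auto simp: power_add)
  have entire'': "egf_entire (\<lambda>k. expectation (\<lambda>\<omega>. \<bar>Z \<omega>\<bar> ^ (k + j)))"
  proof (rule egf_entireI[where A="B ^ j" and B=B])
    show "\<bar>expectation (\<lambda>\<omega>. \<bar>Z \<omega>\<bar> ^ (k + j))\<bar> \<le> B ^ j * B ^ k" for k
      using abs_expectation_le(2)[of "\<lambda>\<omega>. \<bar>Z \<omega>\<bar> ^ (k + j)" "B ^ (k + j)"] Zk[of _ "k + j"]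
      by (simp flip: power_add) (simp add: power_abs add.commute)
  qed
  have int: "integrable M (?f k)" for k
    using m(2)[of "k + j"] by simp
  have sm: "AE \<omega> in M. summable (\<lambda>k. norm (?f k \<omega>))"
    using entire' unfolding egf_entire_def
    by (auto simp: abs_mult power_abs intro!: AE_I2)
  have sn: "summable (\<lambda>k. \<integral>\<omega>. norm (?f k \<omega>) \<partial>M)"
    using entire'' unfolding egf_entire_def
    by (auto simp: abs_mult power_abs)
  have eq: "(\<Sum>k. ?f k \<omega>) = Z \<omega> ^ j * exp (u * Z \<omega>)" for \<omega>
  proof -
    have "(\<lambda>k. Z \<omega> ^ j * ((u * Z \<omega>) ^ k /\<^sub>R fact k)) sums (Z \<omega> ^ j * exp (u * Z \<omega>))"
      by (intro sums_mult exp_converges)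
    also have "(\<lambda>k. Z \<omega> ^ j * ((u * Z \<omega>) ^ k /\<^sub>R fact k)) = (\<lambda>k. ?f k \<omega>)"
      by (simp add: fun_eq_iff power_mult_distrib power_add field_simps)
    finally show ?thesis by (simp add: sums_iff)
  qed
  show "integrable M (\<lambda>\<omega>. Z \<omega> ^ j * exp (u * Z \<omega>))"
    using integrable_suminf[OF int sm sn] by (simp only: eq)
  have "expectation (\<lambda>\<omega>. Z \<omega> ^ j * exp (u * Z \<omega>)) = (\<Sum>k. expectation (?f k))"
    using integral_suminf[OF int sm sn] by (simp only: eq)
  then show "expectation (\<lambda>\<omega>. Z \<omega> ^ j * exp (u * Z \<omega>)) = egf (\<lambda>k. expectation (\<lambda>\<omega>. Z \<omega> ^ (k + j))) u"
    by (simp add: egf_def)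
qed

lemma DERIV_expectation_power_exp:
  fixes Z :: "'a \<Rightarrow> real"
  assumes Z: "Z \<in> borel_measurable M" "\<And>\<omega>. \<bar>Z \<omega>\<bar> \<le> B"
  shows "((\<lambda>u. expectation (\<lambda>\<omega>. Z \<omega> ^ j * exp (u * Z \<omega>))) has_real_derivative
      expectation (\<lambda>\<omega>. Z \<omega> ^ Suc j * exp (u * Z \<omega>))) (at u)"
  unfolding expectation_power_exp(3)[OF Z]
  using DERIV_egf[OF expectation_power_exp(2)[OF Z, of j], of u] by simp

end

locale centered_bounded = prob_space M for M :: "'a measure" +
  fixes X :: "'a \<Rightarrow> real" and b :: real
  assumes X[measurable]: "X \<in> borel_measurable M" and X_le: "\<bar>X \<omega>\<bar> \<le> b" and b_pos: "b > 0"
    and mean: "expectation X = 0"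
begin

definition G :: "nat \<Rightarrow> real \<Rightarrow> real" where
  "G j u = expectation (\<lambda>\<omega>. X \<omega> ^ j * exp (u * X \<omega>))"

definition tilted_var :: "real \<Rightarrow> real" where
  "tilted_var u = G 2 u / G 0 u - (G 1 u / G 0 u)\<^sup>2"

lemma G_int: "integrable M (\<lambda>\<omega>. X \<omega> ^ j * exp (u * X \<omega>))"
  by (rule expectation_power_exp(1)[OF X X_le])

lemma G_DERIV: "(G j has_real_derivative G (Suc j) u) (at u)"
  unfolding G_def[abs_def] by (rule DERIV_expectation_power_exp[OF X X_le])

lemma int_power: "integrable M (\<lambda>\<omega>. X \<omega> ^ k)"
  using G_int[of k 0] by simp

lemma int_X: "integrable M X"
  using int_power[of 1] by simp

lemma exp_bounds:
  assumes "u \<ge> 0"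
  shows "exp (- (u * b)) \<le> exp (u * X \<omega>)" "exp (u * X \<omega>) \<le> exp (u * b)"
proof -
  have "- b \<le> X \<omega>" "X \<omega> \<le> b" using X_le[of \<omega>] by (auto simp: abs_le_iff)
  then have "u * - b \<le> u * X \<omega>" "u * X \<omega> \<le> u * b"
    using assms by (blast intro: mult_left_mono)+
  then show "exp (- (u * b)) \<le> exp (u * X \<omega>)" "exp (u * X \<omega>) \<le> exp (u * b)" by simp_all
qed

lemma G0_bounds:
  assumes "u \<ge> 0"
  shows "exp (- (u * b)) \<le> G 0 u" "G 0 u \<le> exp (u * b)"
proof -
  have "expectation (\<lambda>_. exp (- (u * b))) \<le> G 0 u" unfolding G_def
    using exp_bounds[OF assms] by (intro integral_mono G_int) auto
  then show "exp (- (u * b)) \<le> G 0 u" by (simp add: prob_space)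
  have "G 0 u \<le> expectation (\<lambda>_. exp (u * b))" unfolding G_def
    using exp_bounds[OF assms] by (intro integral_mono G_int) auto
  then show "G 0 u \<le> exp (u * b)" by (simp add: prob_space)
qed

lemma G0_pos: "u \<ge> 0 \<Longrightarrow> G 0 u > 0"
  using G0_bounds(1)[of u] exp_gt_zero[of "- (u * b)"] by linarith

lemma G0_0: "G 0 0 = 1" and G1_0: "G 1 0 = 0"
  by (simp_all add: G_def prob_space mean)

lemma cgf_DERIV:
  assumes "u \<ge> 0"
  shows "((\<lambda>u. ln (G 0 u)) has_real_derivative G 1 u / G 0 u) (at u)"
  using DERIV_ln_divide[OF G0_pos[OF assms]] G_DERIV[of 0 u] DERIV_chain2 by force

lemma cgf_DERIV2:
  assumes "u \<ge> 0"
  shows "((\<lambda>u. G 1 u / G 0 u) has_real_derivative tilted_var u) (at u)"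
proof -
  have "((\<lambda>u. G 1 u / G 0 u) has_real_derivative (G 2 u * G 0 u - G 1 u * G 1 u) / (G 0 u * G 0 u)) (at u)"
    using G0_pos[OF assms] G_DERIV[of 0 u] G_DERIV[of 1 u]
    by (intro DERIV_divide) (auto simp: numeral_2_eq_2)
  also have "(G 2 u * G 0 u - G 1 u * G 1 u) / (G 0 u * G 0 u) = tilted_var u"
    using G0_pos[OF assms] by (simp add: tilted_var_def power2_eq_square field_simps)
  finally show ?thesis .
qed

text \<open>
  The density \<open>exp (u * X) / G 0 u\<close> lies between \<open>exp (- 2 * u * b)\<close> and \<open>exp (2 * u * b)\<close>, and a variance is the
  minimum over \<open>c\<close> of the second moment about \<open>c\<close>.
\<close>
lemma tilted_var_bounds:
  assumes u: "u \<ge> 0"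
  defines "V \<equiv> expectation (\<lambda>\<omega>. (X \<omega>)\<^sup>2)"
  shows "exp (- (2 * u * b)) * V \<le> tilted_var u" "tilted_var u \<le> exp (2 * u * b) * V"
proof -
  note G0 = G0_pos[OF u] G0_bounds[OF u]
  have V0: "V \<ge> 0" by (simp add: V_def)
  have "G 2 u \<le> expectation (\<lambda>\<omega>. exp (u * b) * (X \<omega>)\<^sup>2)"
    unfolding G_def
  proof (intro integral_mono G_int integrable_mult_right int_power)
    show "(X \<omega>)\<^sup>2 * exp (u * X \<omega>) \<le> exp (u * b) * (X \<omega>)\<^sup>2" for \<omega>
      using mult_right_mono[OF exp_bounds(2)[OF u, of \<omega>], of "(X \<omega>)\<^sup>2"] by (simp add: mult.commute)
  qed
  then have G2: "G 2 u \<le> exp (u * b) * V" by (simp add: V_def)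
  have "tilted_var u \<le> G 2 u / G 0 u" by (simp add: tilted_var_def)
  also have "\<dots> \<le> exp (u * b) * V / exp (- (u * b))"
    using G2 G0 V0 by (intro frac_le) auto
  also have "\<dots> = exp (2 * u * b) * V"
    by (simp add: exp_minus field_simps flip: exp_add)
  finally show "tilted_var u \<le> exp (2 * u * b) * V" .
  define c where "c = G 1 u / G 0 u"
  have "exp (- (u * b)) * V \<le> exp (- (u * b)) * (V + c\<^sup>2)" by simp
  also have "\<dots> = expectation (\<lambda>\<omega>. exp (- (u * b)) * (X \<omega> - c)\<^sup>2)"
  proof -
    have "expectation (\<lambda>\<omega>. (X \<omega> - c)\<^sup>2) = expectation (\<lambda>\<omega>. (X \<omega>)\<^sup>2 - 2 * c * X \<omega> + c\<^sup>2)"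
      by (intro Bochner_Integration.integral_cong) (auto simp: power2_eq_square algebra_simps)
    also have "\<dots> = V + c\<^sup>2"
      using int_power[of 2] int_X mean by (simp add: V_def prob_space)
    finally show ?thesis by simp
  qed
  also have "\<dots> \<le> expectation (\<lambda>\<omega>. (X \<omega> - c)\<^sup>2 * exp (u * X \<omega>))"
  proof (rule integral_mono)
    have "integrable M (\<lambda>\<omega>. X \<omega> ^ 2 - 2 * c * X \<omega> + c\<^sup>2)"
      using int_power[of 2] int_X by auto
    then show "integrable M (\<lambda>\<omega>. exp (- (u * b)) * (X \<omega> - c)\<^sup>2)"
      by (intro integrable_mult_right) (simp add: power2_diff algebra_simps)
    have "integrable M (\<lambda>\<omega>. X \<omega> ^ 2 * exp (u * X \<omega>) - 2 * c * (X \<omega> ^ 1 * exp (u * X \<omega>)) + c\<^sup>2 * (X \<omega> ^ 0 * exp (u * X \<omega>)))"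
      by (intro Bochner_Integration.integrable_add Bochner_Integration.integrable_diff integrable_mult_right G_int)
    then show "integrable M (\<lambda>\<omega>. (X \<omega> - c)\<^sup>2 * exp (u * X \<omega>))"
      by (simp add: power2_diff algebra_simps)
    show "exp (- (u * b)) * (X \<omega> - c)\<^sup>2 \<le> (X \<omega> - c)\<^sup>2 * exp (u * X \<omega>)" for \<omega>
      using mult_right_mono[OF exp_bounds(1)[OF u, of \<omega>], of "(X \<omega> - c)\<^sup>2"] by (simp add: mult.commute)
  qed
  also have "\<dots> = expectation (\<lambda>\<omega>. X \<omega> ^ 2 * exp (u * X \<omega>) - 2 * c * (X \<omega> ^ 1 * exp (u * X \<omega>)) + c\<^sup>2 * (X \<omega> ^ 0 * exp (u * X \<omega>)))"
    by (intro Bochner_Integration.integral_cong) (auto simp: power2_diff algebra_simps)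
  also have "\<dots> = G 2 u - 2 * c * G 1 u + c\<^sup>2 * G 0 u"
    unfolding G_def using G_int[of 2 u] G_int[of 1 u] G_int[of 0 u] by simp
  also have "\<dots> = G 0 u * tilted_var u"
    using G0(1) by (simp add: tilted_var_def c_def power2_eq_square field_simps)
  finally have 1: "exp (- (u * b)) * V \<le> G 0 u * tilted_var u" .
  have "0 \<le> exp (- (u * b)) * V" using V0 by simp
  also note 1
  finally have tv0: "0 \<le> tilted_var u" using G0(1) by (simp add: zero_le_mult_iff)
  have "exp (- (2 * u * b)) * V = exp (- (u * b)) * (exp (- (u * b)) * V)"
    by (simp flip: mult.assoc exp_add)
  also have "\<dots> \<le> exp (- (u * b)) * (G 0 u * tilted_var u)"
    using 1 by (intro mult_left_mono) auto
  also have "\<dots> \<le> exp (- (u * b)) * (exp (u * b) * tilted_var u)"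
    using G0 tv0 by (intro mult_left_mono mult_right_mono) auto
  also have "\<dots> = tilted_var u" by (simp flip: mult.assoc exp_add)
  finally show "exp (- (2 * u * b)) * V \<le> tilted_var u" .
qed

text \<open>
  Rescaling to \<open>[0, 1]\<close> makes the moments decrease, and a tilt by \<open>u\<close> of \<open>X\<close> is a tilt by \<open>2 * b * u\<close>
  of \<open>U\<close>.
\<close>
definition U :: "'a \<Rightarrow> real" where "U \<omega> = (X \<omega> + b) / (2 * b)"

definition e :: "nat \<Rightarrow> real" where "e k = expectation (\<lambda>\<omega>. U \<omega> ^ k)"

lemma U_meas[measurable]: "U \<in> borel_measurable M"
  unfolding U_def[abs_def] by measurable

lemma U_01: "0 \<le> U \<omega>" "U \<omega> \<le> 1" "\<bar>U \<omega>\<bar> \<le> 1"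
  using X_le[of \<omega>] b_pos by (auto simp: U_def field_simps abs_le_iff)

lemma U_int: "integrable M (\<lambda>\<omega>. U \<omega> ^ k)"
  using expectation_power_exp(1)[OF U_meas U_01(3), of k 0] by simp

text \<open>
  Positivity follows from Bernoulli's inequality since \<open>2 * U\<close> has mean \<open>1\<close>; log-convexity is the
  Cauchy-Schwarz inequality, obtained from the nonnegative expectation of \<open>U ^ k * (U - r)\<^sup>2\<close>.
\<close>
sublocale moment_sequence e
proof
  show pos: "e k > 0" for k
  proof -
    have "1 = expectation (\<lambda>\<omega>. 1 + real k * (X \<omega> / b))"
      using int_X mean by (simp add: prob_space)
    also have "\<dots> \<le> expectation (\<lambda>\<omega>. 2 ^ k * U \<omega> ^ k)"
    proof (intro integral_mono integrable_mult_right U_int)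
      fix \<omega>
      have "1 + real k * (X \<omega> / b) \<le> (1 + X \<omega> / b) ^ k"
        using X_le[of \<omega>] b_pos by (intro Bernoulli_inequality) (auto simp: field_simps abs_le_iff)
      also have "1 + X \<omega> / b = 2 * U \<omega>" using b_pos by (simp add: U_def field_simps)
      finally show "1 + real k * (X \<omega> / b) \<le> 2 ^ k * U \<omega> ^ k" by (simp add: power_mult_distrib)
    qed (use int_X in auto)
    finally have "1 \<le> 2 ^ k * e k" by (simp add: e_def)
    then show ?thesis by (smt (verit) zero_less_mult_iff zero_less_power)
  qed
  show "e (Suc k) \<le> e k" for k
    unfolding e_def using U_01
    by (intro integral_mono U_int) (auto intro!: mult_left_le_one_le)
  show "(e (Suc k))\<^sup>2 \<le> e k * e (Suc (Suc k))" for k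
  proof -
    define r where "r = e (Suc k) / e k"
    have "0 \<le> expectation (\<lambda>\<omega>. U \<omega> ^ k * (U \<omega> - r)\<^sup>2)"
      using U_01 by (intro Bochner_Integration.integral_nonneg) auto
    also have "\<dots> = expectation (\<lambda>\<omega>. U \<omega> ^ Suc (Suc k) - 2 * r * U \<omega> ^ Suc k + r\<^sup>2 * U \<omega> ^ k)"
      by (intro Bochner_Integration.integral_cong) (auto simp: power2_eq_square algebra_simps)
    also have "\<dots> = e (Suc (Suc k)) - 2 * r * e (Suc k) + r\<^sup>2 * e k"
      unfolding e_def using U_int[of "Suc (Suc k)"] U_int[of "Suc k"] U_int[of k]
      by (simp del: power_Suc)
    also have "\<dots> = (e k * e (Suc (Suc k)) - (e (Suc k))\<^sup>2) / e k"
      using pos[of k] by (simp add: r_def power2_eq_square field_simps)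
    finally show ?thesis using pos[of k] by (simp add: zero_le_divide_iff)
  qed
qed

definition \<mu> :: "nat \<Rightarrow> real" where "\<mu> k = expectation (\<lambda>\<omega>. (X \<omega> + b) ^ k)"

lemma e_eq_\<mu>: "e k = \<mu> k / (2 * b) ^ k"
  by (simp add: e_def \<mu>_def U_def power_divide)

definition \<rho> :: "nat \<Rightarrow> real \<Rightarrow> real" where
  "\<rho> p y = egf (\<lambda>k. truncated_moments p e (Suc k)) y / egf (truncated_moments p e) y"

lemma C_eq_\<rho>: "p \<ge> 1 \<Longrightarrow> C p y (2 * b) \<mu> = (\<rho> p y)\<^sup>2"
  unfolding \<rho>_def using b_pos by (intro C_eq_egf e_eq_\<mu>) auto

lemma \<rho>_pos: "y \<ge> 0 \<Longrightarrow> \<rho> p y > 0"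
  unfolding \<rho>_def using egf_truncated_pos by simp

lemma C_mono:
  assumes "p \<ge> 1" "0 \<le> y" "y \<le> z"
  shows "C p y (2 * b) \<mu> \<le> C p z (2 * b) \<mu>"
  using truncated_log_deriv_mono[OF assms(2,3), of p] \<rho>_pos[OF assms(2), of p]
  unfolding C_eq_\<rho>[OF assms(1)] by (intro power_mono) (auto simp: \<rho>_def less_imp_le)

text \<open>
  At \<open>y = 0\<close> the logarithmic derivative is the quotient of the first two coefficients, and from
  there it increases. This is the
  estimate that bounds the denominator of the exponent from below by a multiple of \<open>D\<close>.
\<close>
lemma C_ge:
  assumes "p \<ge> 1" "0 \<le> y"
  shows "(\<mu> 2 / \<mu> 1)\<^sup>2 \<le> 4 * (b\<^sup>2 * C p y (2 * b) \<mu>)"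
proof -
  have "\<mu> 2 / \<mu> 1 = 2 * b * (e 2 / e 1)"
    using b_pos by (simp add: e_eq_\<mu> power2_eq_square)
  then have "(\<mu> 2 / \<mu> 1)\<^sup>2 = 4 * (b\<^sup>2 * (e 2 / e 1)\<^sup>2)"
    by (simp add: power2_eq_square)
  also have "(e 2 / e 1)\<^sup>2 \<le> (\<rho> p y)\<^sup>2"
    using truncated_log_deriv_ge[OF assms] pos[of 1] pos[of 2]
    by (intro power_mono) (auto simp: \<rho>_def)
  finally show ?thesis using C_eq_\<rho>[OF assms(1)] by (simp add: mult_left_mono)
qed

lemma \<mu>_pos: "\<mu> k > 0"
  using pos[of k] b_pos zero_less_power[of "2 * b" k] unfolding e_eq_\<mu> by (metis zero_less_divide_iff less_asym mult_pos_pos zero_less_numeral)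

text \<open>
  With \<open>B\<close> the tilted mean of \<open>X + b\<close> and \<open>A\<close> its tilted second moment, the tilted variance is
  \<open>A - B\<^sup>2 = (A / B) * B - B\<^sup>2\<close>. Bounding \<open>A / B\<close> by its truncated version \<open>2 * b * \<rho> p y\<close> and maximising the
  quadratic in \<open>B\<close> gives the square of half of that.
\<close>
lemma tilted_var_le_C:
  assumes u: "u \<ge> 0" and p: "p \<ge> 1"
  shows "tilted_var u \<le> b\<^sup>2 * C p (2 * b * u) (2 * b) \<mu>"
proof -
  define y where "y = 2 * b * u"
  have y: "y \<ge> 0" using u b_pos by (simp add: y_def)
  define H where "H = (\<lambda>j. expectation (\<lambda>\<omega>. U \<omega> ^ j * exp (y * U \<omega>)))"
  have H_egf: "H j = egf (\<lambda>k. e (k + j)) y" for j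
    unfolding H_def e_def by (rule expectation_power_exp(3)[OF U_meas U_01(3)])
  have expU: "exp (y * U \<omega>) = exp (u * b) * exp (u * X \<omega>)" for \<omega>
  proof -
    have "y * U \<omega> = u * b + u * X \<omega>" using b_pos by (simp add: y_def U_def field_simps)
    then show ?thesis by (simp add: exp_add)
  qed
  have H0: "H 0 = exp (u * b) * G 0 u"
    by (simp add: H_def G_def expU)
  have twoU1: "2 * b * (U \<omega> ^ 1 * (c * E)) = c * (X \<omega> ^ 1 * E + b * (X \<omega> ^ 0 * E))"
    and twoU2: "(2 * b)\<^sup>2 * (U \<omega> ^ 2 * (c * E)) = c * (X \<omega> ^ 2 * E + 2 * b * (X \<omega> ^ 1 * E) + b\<^sup>2 * (X \<omega> ^ 0 * E))"
    for c E \<omega>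
    using b_pos by (simp_all add: U_def power2_eq_square field_simps)
  have H1: "2 * b * H 1 = exp (u * b) * (G 1 u + b * G 0 u)"
  proof -
    have "2 * b * H 1 = expectation (\<lambda>\<omega>. 2 * b * (U \<omega> ^ 1 * exp (y * U \<omega>)))" by (simp add: H_def)
    also have "\<dots> = expectation (\<lambda>\<omega>. exp (u * b) * (X \<omega> ^ 1 * exp (u * X \<omega>) + b * (X \<omega> ^ 0 * exp (u * X \<omega>))))"
      unfolding expU by (intro Bochner_Integration.integral_cong refl, unfold twoU1[symmetric]) simp
    finally show ?thesis
      unfolding G_def using G_int[of 1 u] G_int[of 0 u] by simp
  qed
  have H2: "(2 * b)\<^sup>2 * H 2 = exp (u * b) * (G 2 u + 2 * b * G 1 u + b\<^sup>2 * G 0 u)"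
  proof -
    have "(2 * b)\<^sup>2 * H 2 = expectation (\<lambda>\<omega>. (2 * b)\<^sup>2 * (U \<omega> ^ 2 * exp (y * U \<omega>)))" by (simp add: H_def)
    also have "\<dots> = expectation (\<lambda>\<omega>. exp (u * b) * (X \<omega> ^ 2 * exp (u * X \<omega>) + 2 * b * (X \<omega> ^ 1 * exp (u * X \<omega>))
        + b\<^sup>2 * (X \<omega> ^ 0 * exp (u * X \<omega>))))"
      unfolding expU by (intro Bochner_Integration.integral_cong refl, unfold twoU2[symmetric]) simp
    finally show ?thesis
      unfolding G_def using G_int[of 2 u] G_int[of 1 u] G_int[of 0 u] by simp
  qed
  have Hpos: "H j > 0" for j
    unfolding H_egf by (intro egf_pos egf_entire_e pos y)
  define B where "B = 2 * b * H 1 / H 0"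
  have "tilted_var u = (2 * b)\<^sup>2 * H 2 / H 0 - B\<^sup>2"
    unfolding B_def H0 H1 H2 tilted_var_def using G0_pos[OF u]
    by (simp add: field_simps power2_eq_square)
  also have "(2 * b)\<^sup>2 * H 2 / H 0 = 2 * b * (H 2 / H 1) * B"
    using Hpos[of 1] by (simp add: B_def power2_eq_square)
  also have "\<dots> \<le> 2 * b * \<rho> p y * B"
  proof (intro mult_right_mono mult_left_mono)
    show "H 2 / H 1 \<le> \<rho> p y"
      using log_deriv_le_truncated[OF y, of p] by (simp add: H_egf \<rho>_def)
  qed (use b_pos Hpos[of 0] Hpos[of 1] in \<open>auto simp: B_def\<close>)
  also have "2 * b * \<rho> p y * B - B\<^sup>2 \<le> (b * \<rho> p y)\<^sup>2"
    using zero_le_power2[of "b * \<rho> p y - B"] by (simp add: power2_eq_square algebra_simps)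
  finally show ?thesis
    unfolding C_eq_\<rho>[OF p] y_def by (simp add: power_mult_distrib)
qed

end


section \<open>Exponential tilting of an independent family\<close>

locale bounded_independent_family = prob_space M for M :: "'a measure" +
  fixes I :: "'i set" and X :: "'i \<Rightarrow> 'a \<Rightarrow> real" and bs :: "'i \<Rightarrow> real" and b :: real
  assumes fin: "finite I"
    and bs: "\<And>i. i \<in> I \<Longrightarrow> 0 < bs i" "\<And>i. i \<in> I \<Longrightarrow> bs i \<le> b"
    and b_pos: "b > 0"
    and indep: "indep_vars (\<lambda>_. borel) X I"
    and X_le: "\<And>i \<omega>. i \<in> I \<Longrightarrow> \<bar>X i \<omega>\<bar> \<le> bs i"
    and X_mean: "\<And>i. i \<in> I \<Longrightarrow> expectation (X i) = 0"
begin

lemma X_meas: "i \<in> I \<Longrightarrow> X i \<in> borel_measurable M"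
  using indep by (auto simp: indep_vars_def)

lemma summand: "i \<in> I \<Longrightarrow> centered_bounded M (X i) (bs i)"
  using X_meas X_le X_mean bs by unfold_locales auto

abbreviation G :: "'i \<Rightarrow> nat \<Rightarrow> real \<Rightarrow> real" where
  "G i \<equiv> centered_bounded.G M (X i)"

abbreviation tilted_mean :: "real \<Rightarrow> 'i \<Rightarrow> real" where
  "tilted_mean l i \<equiv> G i 1 l / G i 0 l"

abbreviation tilted_var :: "real \<Rightarrow> 'i \<Rightarrow> real" where
  "tilted_var l i \<equiv> centered_bounded.tilted_var M (X i) l"

definition cgf :: "real \<Rightarrow> real" where "cgf u = (\<Sum>i\<in>I. ln (G i 0 u))"

definition cgf' :: "real \<Rightarrow> real" where "cgf' u = (\<Sum>i\<in>I. tilted_mean u i)"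

definition cgf'' :: "real \<Rightarrow> real" where "cgf'' u = (\<Sum>i\<in>I. tilted_var u i)"

definition S :: "'a \<Rightarrow> real" where "S \<omega> = (\<Sum>i\<in>I. X i \<omega>)"

lemma S_meas[measurable]: "S \<in> borel_measurable M"
  unfolding S_def[abs_def] using X_meas by measurable

text \<open>
  One summand is independent of any function of the others. The weights \<open>w\<close> are present because the
  factors of the tilting density travel with the variables.
\<close>
lemma expectation_split:
  assumes i: "i \<in> I" and [measurable]: "f \<in> borel_measurable borel" "g \<in> borel_measurable borel"
    "\<And>j. w j \<in> borel_measurable borel"
    and f: "\<And>\<omega>. \<bar>f (X i \<omega>)\<bar> \<le> Bf" and g: "\<And>\<omega>. \<bar>g (\<Sum>j\<in>I - {i}. X j \<omega>)\<bar> \<le> Bg"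
    and w: "\<And>j \<omega>. j \<in> I \<Longrightarrow> \<bar>w j (X j \<omega>)\<bar> \<le> Bw j"
  shows "expectation (\<lambda>\<omega>. f (X i \<omega>) * ((\<Prod>j\<in>I - {i}. w j (X j \<omega>)) * g (\<Sum>j\<in>I - {i}. X j \<omega>)))
    = expectation (\<lambda>\<omega>. f (X i \<omega>)) * expectation (\<lambda>\<omega>. (\<Prod>j\<in>I - {i}. w j (X j \<omega>)) * g (\<Sum>j\<in>I - {i}. X j \<omega>) :: real)"
proof -
  let ?J = "I - {i}"
  define H where "H = (\<lambda>x. (\<Prod>j\<in>?J. w j (x j)) * g (\<Sum>j\<in>?J. x j))"
  have [measurable]: "H \<in> borel_measurable (PiM ?J (\<lambda>_. borel))"
    unfolding H_def by measurable
  have H: "H (\<lambda>j\<in>?J. X j \<omega>) = (\<Prod>j\<in>?J. w j (X j \<omega>)) * g (\<Sum>j\<in>?J. X j \<omega>)" for \<omega>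
    unfolding H_def by (intro arg_cong2[where f="(*)"] prod.cong arg_cong[where f=g] sum.cong) auto
  note [measurable] = X_meas[OF i]
  have Hmeas: "(\<lambda>\<omega>. H (\<lambda>j\<in>?J. X j \<omega>)) \<in> borel_measurable M"
    using X_meas by (intro measurable_compose[OF measurable_restrict \<open>H \<in> _\<close>]) auto
  have "indep_var (PiM {i} (\<lambda>_. borel)) (\<lambda>\<omega>. restrict (\<lambda>j. X j \<omega>) {i}) (PiM ?J (\<lambda>_. borel)) (\<lambda>\<omega>. restrict (\<lambda>j. X j \<omega>) ?J)"
    by (rule indep_var_restrict[OF indep]) (use i in auto)
  then have "indep_var borel ((\<lambda>x. f (x i)) \<circ> (\<lambda>\<omega>. restrict (\<lambda>j. X j \<omega>) {i})) borel (H \<circ> (\<lambda>\<omega>. restrict (\<lambda>j. X j \<omega>) ?J))"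
    by (rule indep_var_compose) measurable
  then have ind: "indep_var borel (\<lambda>\<omega>. f (X i \<omega>)) borel (\<lambda>\<omega>. H (restrict (\<lambda>j. X j \<omega>) ?J))"
    by (simp add: comp_def)
  have HB: "\<bar>H (restrict (\<lambda>j. X j \<omega>) ?J)\<bar> \<le> (\<Prod>j\<in>?J. Bw j) * Bg" for \<omega>
    unfolding H abs_mult abs_prod using g w
    by (intro mult_mono prod_mono prod_nonneg) (auto intro: order_trans[OF abs_ge_zero])
  have int: "integrable M (\<lambda>\<omega>. f (X i \<omega>))" "integrable M (\<lambda>\<omega>. H (restrict (\<lambda>j. X j \<omega>) ?J))"
    using abs_expectation_le(1)[OF Hmeas HB] abs_expectation_le(1)[of "\<lambda>\<omega>. f (X i \<omega>)", OF _ f] by auto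
  show ?thesis
    using indep_var_lebesgue_integral[OF ind int] unfolding H .
qed

lemma sum_bdd: "J \<subseteq> I \<Longrightarrow> \<bar>\<Sum>j\<in>J. X j \<omega>\<bar> \<le> (\<Sum>j\<in>I. bs j)"
proof -
  assume J: "J \<subseteq> I"
  have "\<bar>\<Sum>j\<in>J. X j \<omega>\<bar> \<le> (\<Sum>j\<in>J. \<bar>X j \<omega>\<bar>)" by (rule sum_abs)
  also have "\<dots> \<le> (\<Sum>j\<in>J. bs j)" using J X_le by (intro sum_mono) auto
  also have "\<dots> \<le> (\<Sum>j\<in>I. bs j)" using J fin bs by (intro sum_mono2) (auto intro: less_imp_le)
  finally show ?thesis .
qed

lemma variance_S: "expectation (\<lambda>\<omega>. (S \<omega>)\<^sup>2) = (\<Sum>i\<in>I. expectation (\<lambda>\<omega>. (X i \<omega>)\<^sup>2))"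
proof -
  have bdd: "\<bar>X i \<omega> * Y\<bar> \<le> bs i * B" if "i \<in> I" "\<bar>Y\<bar> \<le> B" for i \<omega> Y B
    unfolding abs_mult using that X_le bs by (intro mult_mono) (auto intro: less_imp_le)
  have int: "integrable M (\<lambda>\<omega>. X i \<omega> * (\<Sum>j\<in>J. X j \<omega>))" if "i \<in> I" "J \<subseteq> I" for i J
  proof (rule abs_expectation_le(1))
    show "\<bar>X i \<omega> * (\<Sum>j\<in>J. X j \<omega>)\<bar> \<le> bs i * (\<Sum>j\<in>I. bs j)" for \<omega>
      by (rule bdd[OF that(1) sum_bdd[OF that(2)]])
    show "(\<lambda>\<omega>. X i \<omega> * (\<Sum>j\<in>J. X j \<omega>)) \<in> borel_measurable M"
      using that X_meas by (intro borel_measurable_times borel_measurable_sum) auto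
  qed
  have "expectation (\<lambda>\<omega>. (S \<omega>)\<^sup>2) = expectation (\<lambda>\<omega>. \<Sum>i\<in>I. X i \<omega> * (\<Sum>j\<in>I. X j \<omega>))"
    by (simp add: S_def power2_eq_square sum_distrib_right)
  also have "\<dots> = (\<Sum>i\<in>I. expectation (\<lambda>\<omega>. X i \<omega> * (\<Sum>j\<in>I. X j \<omega>)))"
    by (intro Bochner_Integration.integral_sum int) auto
  also have "\<dots> = (\<Sum>i\<in>I. expectation (\<lambda>\<omega>. (X i \<omega>)\<^sup>2))"
  proof (rule sum.cong[OF refl])
    fix i assume i: "i \<in> I"
    have "expectation (\<lambda>\<omega>. X i \<omega> * (\<Sum>j\<in>I. X j \<omega>))
        = expectation (\<lambda>\<omega>. X i \<omega> * (\<Sum>j\<in>{i}. X j \<omega>) + X i \<omega> * (\<Sum>j\<in>I - {i}. X j \<omega>))"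
      using i fin by (intro Bochner_Integration.integral_cong refl) (simp add: sum.remove[of I i] distrib_left)
    also have "\<dots> = expectation (\<lambda>\<omega>. X i \<omega> * (\<Sum>j\<in>{i}. X j \<omega>)) + expectation (\<lambda>\<omega>. X i \<omega> * (\<Sum>j\<in>I - {i}. X j \<omega>))"
      using i by (intro Bochner_Integration.integral_add int) auto
    also have "expectation (\<lambda>\<omega>. X i \<omega> * (\<Sum>j\<in>I - {i}. X j \<omega>)) = 0"
      using expectation_split[OF i, of "\<lambda>x. x" "\<lambda>x. x" "\<lambda>_ _. 1" "bs i" "\<Sum>j\<in>I. bs j" "\<lambda>_. 1"]
        X_le[OF i] sum_bdd[of "I - {i}"] X_mean[OF i] by auto
    finally show "expectation (\<lambda>\<omega>. X i \<omega> * (\<Sum>j\<in>I. X j \<omega>)) = expectation (\<lambda>\<omega>. (X i \<omega>)\<^sup>2)"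
      by (simp add: power2_eq_square)
  qed
  finally show ?thesis .
qed

text \<open>
  The tilting density is the product of the \<open>w i (X i)\<close>, so that summand \<open>i\<close> and the remaining ones still separate
  under \<open>Q\<close>, and the standardised sum satisfies the leave-one-out conditions with \<open>a = 2 * b / s\<close>.
  Undoing the tilt on the event \<open>S \<ge> t\<close> leaves the Laplace transform of \<open>W\<close> on the half line at
  \<open>l * s\<close>. The constant is \<open>34 * 2\<close>.
\<close>
lemma tilt_bound:
  assumes l: "l > 0" and t: "cgf' l = t" and pos: "cgf'' l > 0"
  defines "s \<equiv> sqrt (cgf'' l)"
  shows "prob {\<omega>\<in>space M. S \<omega> \<ge> t} \<le> exp (cgf l - l * t) * (\<theta> (l * s) + 68 * b / s)"
proof -
  have s: "s > 0" "s\<^sup>2 = cgf'' l" using pos by (auto simp: s_def)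
  have G0: "G i 0 l > 0" if "i \<in> I" for i
    using centered_bounded.G0_pos[OF summand[OF that]] l by simp
  define w where "w = (\<lambda>i x. exp (l * x) / G i 0 l)"
  have w_meas[measurable]: "w i \<in> borel_measurable borel" for i unfolding w_def by measurable
  have w_pos: "w i x > 0" if "i \<in> I" for i x using G0[OF that] by (simp add: w_def)
  have w_le: "\<bar>w i (X i \<omega>)\<bar> \<le> exp (l * bs i) / G i 0 l" if "i \<in> I" for i \<omega>
    using centered_bounded.exp_bounds(2)[OF summand[OF that], of l \<omega>] l G0[OF that]
    by (simp add: w_def divide_right_mono mult.commute)
  define D where "D = (\<lambda>\<omega>. \<Prod>i\<in>I. w i (X i \<omega>))"
  have D_meas[measurable]: "D \<in> borel_measurable M"
    unfolding D_def by (intro borel_measurable_prod measurable_compose[OF X_meas w_meas])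
  have D_pos: "D \<omega> > 0" for \<omega> unfolding D_def using w_pos by (intro prod_pos) auto
  have D_eq: "D \<omega> = exp (l * S \<omega> - cgf l)" for \<omega>
  proof -
    have "D \<omega> = (\<Prod>i\<in>I. exp (l * X i \<omega> - ln (G i 0 l)))"
      unfolding D_def w_def using G0 by (intro prod.cong refl) (simp add: exp_diff)
    also have "\<dots> = exp (l * S \<omega> - cgf l)"
      by (simp add: S_def cgf_def sum_subtractf sum_distrib_left flip: exp_sum[OF fin])
    finally show ?thesis .
  qed
  have D_split: "D \<omega> = w i (X i \<omega>) * (\<Prod>j\<in>I - {i}. w j (X j \<omega>))" if "i \<in> I" for i \<omega>
    unfolding D_def using that fin by (simp add: prod.remove)
  have int_pow: "integrable M (\<lambda>\<omega>. X i \<omega> ^ k * exp (l * X i \<omega>))" if "i \<in> I" for i k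
    by (rule centered_bounded.G_int[OF summand[OF that]])
  have Ew: "expectation (\<lambda>\<omega>. w i (X i \<omega>) * X i \<omega> ^ k) = G i k l / G i 0 l"
    "integrable M (\<lambda>\<omega>. w i (X i \<omega>) * X i \<omega> ^ k)" if "i \<in> I" for i k
  proof -
    have eq: "(\<lambda>\<omega>. w i (X i \<omega>) * X i \<omega> ^ k) = (\<lambda>\<omega>. (X i \<omega> ^ k * exp (l * X i \<omega>)) / G i 0 l)"
      by (simp add: w_def fun_eq_iff)
    show "expectation (\<lambda>\<omega>. w i (X i \<omega>) * X i \<omega> ^ k) = G i k l / G i 0 l"
      unfolding eq by (simp add: centered_bounded.G_def[OF summand[OF that]])
    show "integrable M (\<lambda>\<omega>. w i (X i \<omega>) * X i \<omega> ^ k)"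
      unfolding eq using int_pow[OF that, of k] by simp
  qed
  have Ew0: "expectation (\<lambda>\<omega>. w i (X i \<omega>)) = 1" if "i \<in> I" for i
    using Ew(1)[OF that, of 0] G0[OF that] by simp
  have D_bdd: "\<bar>D \<omega>\<bar> \<le> (\<Prod>i\<in>I. exp (l * bs i) / G i 0 l)" for \<omega>
    unfolding D_def abs_prod using w_le by (intro prod_mono) auto
  have D_int: "integrable M D" by (rule abs_expectation_le(1)[OF D_meas D_bdd])
  have ED: "expectation D = 1"
  proof -
    have "expectation D = (\<Prod>i\<in>I. expectation (\<lambda>\<omega>. w i (X i \<omega>)))"
      unfolding D_def
      by (rule indep_vars_lebesgue_integral[OF fin])
         (use indep_vars_compose2[OF indep, of w "\<lambda>_. borel"] Ew(2)[of _ 0] in auto)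
    then show ?thesis using Ew0 by simp
  qed
  define Q where "Q = density M (\<lambda>\<omega>. ennreal (D \<omega>))"
  have EQ: "integral\<^sup>L Q f = expectation (\<lambda>\<omega>. D \<omega> * f \<omega>)" if "f \<in> borel_measurable M" for f :: "'a \<Rightarrow> real"
    unfolding Q_def using that D_pos by (subst integral_density) (auto intro: less_imp_le)
  have Q: "prob_space Q"
  proof (rule prob_spaceI)
    have "emeasure Q (space Q) = (\<integral>\<^sup>+\<omega>. ennreal (D \<omega>) \<partial>M)"
      unfolding Q_def by (subst emeasure_density) (auto intro!: nn_integral_cong)
    also have "\<dots> = ennreal (expectation D)"
      using D_int D_pos by (intro nn_integral_eq_integral) (auto intro: less_imp_le)
    finally show "emeasure Q (space Q) = 1" by (simp add: ED)
  qed
  define m where "m = tilted_mean l"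
  have m_le: "\<bar>m i\<bar> \<le> bs i" if i: "i \<in> I" for i
  proof -
    have "\<bar>m i\<bar> = \<bar>expectation (\<lambda>\<omega>. w i (X i \<omega>) * X i \<omega> ^ 1)\<bar>" by (simp only: Ew(1)[OF i] m_def)
    also have "\<dots> \<le> expectation (\<lambda>\<omega>. \<bar>w i (X i \<omega>) * X i \<omega> ^ 1\<bar>)" by (rule integral_abs_bound)
    also have "\<dots> \<le> expectation (\<lambda>\<omega>. w i (X i \<omega>) * bs i)"
    proof (intro integral_mono integrable_abs Ew(2)[OF i])
      show "integrable M (\<lambda>\<omega>. w i (X i \<omega>) * bs i)" using Ew(2)[OF i, of 0] by simp
      show "\<bar>w i (X i \<omega>) * X i \<omega> ^ 1\<bar> \<le> w i (X i \<omega>) * bs i" for \<omega>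
        using w_pos[OF i, of "X i \<omega>"] X_le[OF i] by (simp add: abs_mult)
    qed
    also have "\<dots> = bs i" using Ew0[OF i] by simp
    finally show ?thesis .
  qed
  define \<xi> where "\<xi> = (\<lambda>i \<omega>. (X i \<omega> - m i) / s)"
  define W where "W = (\<lambda>\<omega>. \<Sum>i\<in>I. \<xi> i \<omega>)"
  have W_eq: "W \<omega> = (S \<omega> - t) / s" for \<omega>
    by (simp add: W_def \<xi>_def S_def m_def sum_subtractf cgf'_def flip: t sum_divide_distrib)
  have W_loo: "W \<omega> - \<xi> i \<omega> = ((\<Sum>j\<in>I - {i}. X j \<omega>) - (\<Sum>j\<in>I - {i}. m j)) / s" if "i \<in> I" for i \<omega>
  proof -
    have "W \<omega> - \<xi> i \<omega> = (\<Sum>j\<in>I - {i}. \<xi> j \<omega>)" using that fin by (simp add: W_def sum.remove)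
    then show ?thesis by (simp add: \<xi>_def flip: sum_subtractf sum_divide_distrib)
  qed
  \<comment> \<open>under \<open>Q\<close> as well, summand \<open>i\<close> separates from the others: the weights \<open>w j\<close> with \<open>j \<noteq> i\<close> stay with the second expectation\<close>
  have factor: "integral\<^sup>L Q (\<lambda>\<omega>. f (X i \<omega>) * g (W \<omega> - \<xi> i \<omega>))
      = expectation (\<lambda>\<omega>. w i (X i \<omega>) * f (X i \<omega>)) * integral\<^sup>L Q (\<lambda>\<omega>. g (W \<omega> - \<xi> i \<omega>))"
    if i: "i \<in> I" and f[measurable]: "f \<in> borel_measurable borel" and g[measurable]: "g \<in> borel_measurable borel"
      and fB: "\<And>\<omega>. \<bar>f (X i \<omega>)\<bar> \<le> Bf" and gB: "\<And>\<omega>. \<bar>g (W \<omega> - \<xi> i \<omega>)\<bar> \<le> Bg" for i f g Bf Bg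
  proof -
    define g' where "g' = (\<lambda>z. g ((z - (\<Sum>j\<in>I - {i}. m j)) / s))"
    have [measurable]: "g' \<in> borel_measurable borel" unfolding g'_def by measurable
    have g': "g (W \<omega> - \<xi> i \<omega>) = g' (\<Sum>j\<in>I - {i}. X j \<omega>)" for \<omega>
      by (simp add: g'_def W_loo[OF i])
    have meas: "(\<lambda>\<omega>. g' (\<Sum>j\<in>I - {i}. X j \<omega>)) \<in> borel_measurable M"
      by (intro measurable_compose[OF borel_measurable_sum]) (use X_meas in auto)
    have key: "integral\<^sup>L Q (\<lambda>\<omega>. f (X i \<omega>) * g (W \<omega> - \<xi> i \<omega>)) = expectation (\<lambda>\<omega>. w i (X i \<omega>) * f (X i \<omega>)) *
        expectation (\<lambda>\<omega>. (\<Prod>j\<in>I - {i}. w j (X j \<omega>)) * g' (\<Sum>j\<in>I - {i}. X j \<omega>))"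
      if [measurable]: "f \<in> borel_measurable borel" and fB: "\<And>\<omega>. \<bar>f (X i \<omega>)\<bar> \<le> Bf" for f Bf
    proof -
      have "integral\<^sup>L Q (\<lambda>\<omega>. f (X i \<omega>) * g (W \<omega> - \<xi> i \<omega>))
          = expectation (\<lambda>\<omega>. (\<lambda>x. w i x * f x) (X i \<omega>) * ((\<Prod>j\<in>I - {i}. w j (X j \<omega>)) * g' (\<Sum>j\<in>I - {i}. X j \<omega>)))"
        unfolding g' using X_meas[OF i] meas
        by (subst EQ) (auto simp: D_split[OF i] mult_ac)
      also have "\<dots> = expectation (\<lambda>\<omega>. w i (X i \<omega>) * f (X i \<omega>)) *
        expectation (\<lambda>\<omega>. (\<Prod>j\<in>I - {i}. w j (X j \<omega>)) * g' (\<Sum>j\<in>I - {i}. X j \<omega>))"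
      proof (rule expectation_split[OF i, where Bf="exp (l * bs i) / G i 0 l * Bf" and Bg=Bg and Bw="\<lambda>i. exp (l * bs i) / G i 0 l"])
        show "\<bar>w i (X i \<omega>) * f (X i \<omega>)\<bar> \<le> exp (l * bs i) / G i 0 l * Bf" for \<omega>
          unfolding abs_mult using w_le[OF i] fB G0[OF i] by (intro mult_mono) auto
        show "\<bar>g' (\<Sum>j\<in>I - {i}. X j \<omega>)\<bar> \<le> Bg" for \<omega>
          using gB by (simp flip: g')
      qed (use w_le in auto)
      finally show ?thesis .
    qed
    show ?thesis
      using key[OF f fB] key[of "\<lambda>_. 1" 1] Ew0[OF i] by simp
  qed
  have first: "expectation (\<lambda>\<omega>. w i (X i \<omega>) * ((X i \<omega> - m i) / s)) = 0" if i: "i \<in> I" for i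
  proof -
    have "expectation (\<lambda>\<omega>. w i (X i \<omega>) * ((X i \<omega> - m i) / s))
        = expectation (\<lambda>\<omega>. (w i (X i \<omega>) * X i \<omega> ^ 1 - m i * (w i (X i \<omega>) * X i \<omega> ^ 0)) / s)"
      by (intro Bochner_Integration.integral_cong) (auto simp: algebra_simps)
    also have "\<dots> = (G i 1 l / G i 0 l - m i * (G i 0 l / G i 0 l)) / s"
      using Ew[OF i, of 1] Ew[OF i, of 0] by simp
    also have "\<dots> = 0" using G0[OF i] by (simp add: m_def)
    finally show ?thesis .
  qed
  have second: "expectation (\<lambda>\<omega>. w i (X i \<omega>) * ((X i \<omega> - m i) / s)\<^sup>2) = tilted_var l i / s\<^sup>2" if i: "i \<in> I" for i
  proof -
    have "expectation (\<lambda>\<omega>. w i (X i \<omega>) * ((X i \<omega> - m i) / s)\<^sup>2)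
        = expectation (\<lambda>\<omega>. (w i (X i \<omega>) * X i \<omega> ^ 2 - 2 * m i * (w i (X i \<omega>) * X i \<omega> ^ 1)
           + (m i)\<^sup>2 * (w i (X i \<omega>) * X i \<omega> ^ 0)) / s\<^sup>2)"
      by (intro Bochner_Integration.integral_cong) (auto simp: algebra_simps power2_eq_square)
    also have "\<dots> = (G i 2 l / G i 0 l - 2 * m i * (G i 1 l / G i 0 l) + (m i)\<^sup>2 * (G i 0 l / G i 0 l)) / s\<^sup>2"
      using Ew[OF i, of 2] Ew[OF i, of 1] Ew[OF i, of 0] by simp
    also have "\<dots> = tilted_var l i / s\<^sup>2"
      using G0[OF i] by (simp add: m_def centered_bounded.tilted_var_def[OF summand[OF i]] power2_eq_square)
    finally show ?thesis .
  qed
  have \<xi>_le: "\<bar>\<xi> i \<omega>\<bar> \<le> 2 * b / s" if i: "i \<in> I" for i \<omega>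
  proof -
    have "\<bar>X i \<omega> - m i\<bar> \<le> 2 * b" using X_le[OF i, of \<omega>] m_le[OF i] bs(2)[OF i] by linarith
    then show ?thesis using s by (simp add: \<xi>_def abs_divide divide_right_mono)
  qed
  interpret Q: leave_one_out Q I \<xi> "\<lambda>i. tilted_var l i / s\<^sup>2" "2 * b / s" W
    unfolding W_def
  proof (intro leave_one_out.intro Q leave_one_out_axioms.intro)
    show "finite I" by (rule fin)
    show "0 < 2 * b / s" using b_pos s by simp
    show "(\<Sum>i\<in>I. tilted_var l i / s\<^sup>2) = 1"
      using s pos by (simp add: cgf''_def flip: sum_divide_distrib)
    fix i assume i: "i \<in> I"
    show "\<xi> i \<in> borel_measurable Q" unfolding \<xi>_def Q_def using X_meas[OF i] by measurable
    show "\<bar>\<xi> i \<omega>\<bar> \<le> 2 * b / s" for \<omega> by (rule \<xi>_le[OF i])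
    fix g :: "real \<Rightarrow> real" and B
    assume g: "g \<in> borel_measurable borel" "\<And>\<omega>. \<bar>g ((\<Sum>i\<in>I. \<xi> i \<omega>) - \<xi> i \<omega>)\<bar> \<le> B"
    have gB: "\<bar>g (W \<omega> - \<xi> i \<omega>)\<bar> \<le> B" for \<omega> using g(2) by (simp only: W_def)
    have XB: "\<bar>(X i \<omega> - m i) / s\<bar> \<le> 2 * b / s" for \<omega> using \<xi>_le[OF i] by (simp only: \<xi>_def)
    have "integral\<^sup>L Q (\<lambda>\<omega>. (X i \<omega> - m i) / s * g (W \<omega> - \<xi> i \<omega>)) = 0"
      by (subst factor[OF i, of "\<lambda>x. (x - m i) / s" g "2 * b / s" B, OF _ g(1) XB gB]) (simp_all only: first[OF i] mult_zero_left, measurable)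
    then show "integral\<^sup>L Q (\<lambda>\<omega>. \<xi> i \<omega> * g ((\<Sum>i\<in>I. \<xi> i \<omega>) - \<xi> i \<omega>)) = 0"
      by (simp only: \<xi>_def W_def)
    have XB2: "\<bar>((X i \<omega> - m i) / s)\<^sup>2\<bar> \<le> (2 * b / s)\<^sup>2" for \<omega>
      using power_mono[OF XB[of \<omega>] abs_ge_zero, of 2] by (simp only: power2_abs abs_power2)
    have "integral\<^sup>L Q (\<lambda>\<omega>. ((X i \<omega> - m i) / s)\<^sup>2 * g (W \<omega> - \<xi> i \<omega>))
        = tilted_var l i / s\<^sup>2 * integral\<^sup>L Q (\<lambda>\<omega>. g (W \<omega> - \<xi> i \<omega>))"
      by (subst factor[OF i, of "\<lambda>x. ((x - m i) / s)\<^sup>2" g "(2 * b / s)\<^sup>2" B, OF _ g(1) XB2 gB]) (simp_all only: second[OF i], measurable)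
    then show "integral\<^sup>L Q (\<lambda>\<omega>. (\<xi> i \<omega>)\<^sup>2 * g ((\<Sum>i\<in>I. \<xi> i \<omega>) - \<xi> i \<omega>))
        = tilted_var l i / s\<^sup>2 * integral\<^sup>L Q (\<lambda>\<omega>. g ((\<Sum>i\<in>I. \<xi> i \<omega>) - \<xi> i \<omega>))"
      by (simp only: \<xi>_def W_def)
  qed
  have "prob {\<omega>\<in>space M. S \<omega> \<ge> t} = expectation (\<lambda>\<omega>. indicator {\<omega>\<in>space M. S \<omega> \<ge> t} \<omega>)"
    by simp
  also have "\<dots> = expectation (\<lambda>\<omega>. exp (cgf l - l * t) * (D \<omega> * (indicator {0..} (W \<omega>) * exp (- (l * s * W \<omega>)))))"
  proof (intro Bochner_Integration.integral_cong refl)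
    fix \<omega> assume "\<omega> \<in> space M"
    have sW: "l * s * W \<omega> = l * (S \<omega> - t)" using s by (simp add: W_eq)
    have "exp (cgf l - l * t) * (D \<omega> * exp (- (l * s * W \<omega>))) = 1"
      unfolding sW D_eq by (simp add: algebra_simps flip: exp_add)
    then show "indicator {\<omega>\<in>space M. S \<omega> \<ge> t} \<omega>
        = exp (cgf l - l * t) * (D \<omega> * (indicator {0..} (W \<omega>) * exp (- (l * s * W \<omega>))))"
      using \<open>\<omega> \<in> space M\<close> s by (auto simp: W_eq zero_le_divide_iff split: split_indicator)
  qed
  also have "\<dots> = exp (cgf l - l * t) * integral\<^sup>L Q (\<lambda>\<omega>. indicator {0..} (W \<omega>) * exp (- (l * s * W \<omega>)))"
    by (subst EQ) (auto simp: W_eq)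
  also have "\<dots> \<le> exp (cgf l - l * t) * (\<theta> (l * s) + 34 * (2 * b / s))"
    using Q.laplace_bound[of "l * s"] l s by (intro mult_left_mono) auto
  finally show ?thesis by simp
qed

end


section \<open>The tail bound\<close>

context bounded_independent_family
begin

abbreviation \<mu> :: "'i \<Rightarrow> nat \<Rightarrow> real" where
  "\<mu> i \<equiv> centered_bounded.\<mu> M (X i) (bs i)"

definition \<sigma>2 :: real where "\<sigma>2 = (\<Sum>i\<in>I. expectation (\<lambda>\<omega>. (X i \<omega>)\<^sup>2))"

lemma cgf_DERIV:
  assumes "u \<ge> 0"
  shows "(cgf has_real_derivative cgf' u) (at u)" "(cgf' has_real_derivative cgf'' u) (at u)"
proof -
  show "(cgf has_real_derivative cgf' u) (at u)" unfolding cgf_def[abs_def] cgf'_def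
    by (intro DERIV_sum centered_bounded.cgf_DERIV[OF summand assms])
  show "(cgf' has_real_derivative cgf'' u) (at u)" unfolding cgf'_def[abs_def] cgf''_def
    by (intro DERIV_sum centered_bounded.cgf_DERIV2[OF summand assms])
qed

lemma cgf_0: "cgf 0 = 0" "cgf' 0 = 0"
  using centered_bounded.G0_0[OF summand] centered_bounded.G1_0[OF summand]
  by (simp_all add: cgf_def cgf'_def)

lemma cgf''_bounds:
  assumes u: "u \<ge> 0"
  shows "exp (- (2 * u * b)) * \<sigma>2 \<le> cgf'' u" "cgf'' u \<le> exp (2 * u * b) * \<sigma>2"
proof -
  have "exp (- (2 * u * b)) * expectation (\<lambda>\<omega>. (X i \<omega>)\<^sup>2) \<le> tilted_var u i
      \<and> tilted_var u i \<le> exp (2 * u * b) * expectation (\<lambda>\<omega>. (X i \<omega>)\<^sup>2)" if i: "i \<in> I" for i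
  proof -
    have "2 * u * bs i \<le> 2 * u * b" using u bs(2)[OF i] by (intro mult_left_mono) auto
    then have "exp (- (2 * u * b)) * expectation (\<lambda>\<omega>. (X i \<omega>)\<^sup>2) \<le> exp (- (2 * u * bs i)) * expectation (\<lambda>\<omega>. (X i \<omega>)\<^sup>2)"
      "exp (2 * u * bs i) * expectation (\<lambda>\<omega>. (X i \<omega>)\<^sup>2) \<le> exp (2 * u * b) * expectation (\<lambda>\<omega>. (X i \<omega>)\<^sup>2)"
      by (auto intro!: mult_right_mono)
    then show ?thesis using centered_bounded.tilted_var_bounds[OF summand[OF i] u] by linarith
  qed
  then show "exp (- (2 * u * b)) * \<sigma>2 \<le> cgf'' u" "cgf'' u \<le> exp (2 * u * b) * \<sigma>2"
    unfolding \<sigma>2_def cgf''_def sum_distrib_left by (auto intro!: sum_mono)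
qed

lemma \<sigma>2_nonneg: "\<sigma>2 \<ge> 0"
  unfolding \<sigma>2_def by (intro sum_nonneg) simp

lemma cgf''_nonneg: "u \<ge> 0 \<Longrightarrow> cgf'' u \<ge> 0"
  using cgf''_bounds(1)[of u] \<sigma>2_nonneg by (meson exp_ge_zero mult_nonneg_nonneg order_trans)

lemma cgf'_mono: "0 \<le> u \<Longrightarrow> u \<le> w \<Longrightarrow> cgf' u \<le> cgf' w"
  by (rule DERIV_nonneg_imp_nondecreasing) (auto intro!: exI cgf_DERIV(2) cgf''_nonneg)

lemma cgf'_mean_value:
  assumes "u > 0"
  obtains z where "0 < z" "z < u" "cgf' u = u * cgf'' z"
proof -
  obtain z where "0 < z" "z < u" "cgf' u - cgf' 0 = (u - 0) * cgf'' z"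
    using MVT2[of 0 u cgf' cgf''] assms cgf_DERIV(2) by auto
  then show thesis using that cgf_0 by simp
qed

text \<open>
  The function \<open>cgf u - u * t\<close> is convex with a critical point at \<open>l\<close>.
\<close>
lemma legendre_min:
  assumes l: "l \<ge> 0" and u: "u \<ge> 0" and t: "cgf' l = t"
  shows "cgf l - l * t \<le> cgf u - u * t"
proof (cases u l rule: linorder_cases)
  case less
  then obtain z where z: "u < z" "z < l" "cgf l - cgf u = (l - u) * cgf' z"
    using MVT2[of u l cgf cgf'] u cgf_DERIV(1) by auto
  have "(l - u) * cgf' z \<le> (l - u) * t"
    using z u cgf'_mono[of z l] t by (intro mult_left_mono) auto
  then show ?thesis using z by (simp add: algebra_simps)
next
  case greater
  then obtain z where z: "l < z" "z < u" "cgf u - cgf l = (u - l) * cgf' z"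
    using MVT2[of l u cgf cgf'] l cgf_DERIV(1) by auto
  have "(u - l) * t \<le> (u - l) * cgf' z"
    using z l cgf'_mono[of l z] t by (intro mult_left_mono) auto
  then show ?thesis using z by (simp add: algebra_simps)
qed simp

lemma cgf_le_quadratic:
  assumes u: "u > 0" and V: "\<And>z. 0 \<le> z \<Longrightarrow> z \<le> u \<Longrightarrow> cgf'' z \<le> V"
  shows "cgf u \<le> u\<^sup>2 * V / 2"
proof -
  have 1: "cgf' z \<le> z * V" if z: "0 < z" "z < u" for z
  proof -
    obtain y where "0 < y" "y < z" "cgf' z = z * cgf'' y" using cgf'_mean_value[OF z(1)] .
    then show ?thesis using V[of y] z by (simp add: mult_left_mono)
  qed
  let ?f = "\<lambda>z. cgf z - z\<^sup>2 * V / 2"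
  have "\<exists>z>0. z < u \<and> ?f u - ?f 0 = (u - 0) * (cgf' z - z * V)"
  proof (rule MVT2[OF u])
    fix z assume "0 \<le> z" "z \<le> u"
    then show "(?f has_real_derivative cgf' z - z * V) (at z)"
      by (auto intro!: derivative_eq_intros cgf_DERIV(1))
  qed
  then obtain z where "0 < z" "z < u" "cgf u - u\<^sup>2 * V / 2 = u * (cgf' z - z * V)"
    using cgf_0 by auto
  moreover from this have "u * (cgf' z - z * V) \<le> 0" using 1[of z] u by (simp add: mult_nonneg_nonpos)
  ultimately show ?thesis by linarith
qed

text \<open>
  The sum \<open>V\<close> bounds \<open>cgf''\<close> at arguments up to \<open>4 * t / D\<close>, since \<open>C\<close> enters it at \<open>8 * t * bs i / D\<close>. The
  minimiser \<open>t / V\<close> of \<open>u\<^sup>2 * V / 2 - u * t\<close> lies in this range because each summand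
  of \<open>V\<close> is at least a quarter of the corresponding summand of \<open>D\<close>.
\<close>
lemma exponent_bound:
  assumes I: "I \<noteq> {}" and t: "t > 0" and p: "p \<ge> 1" and l: "l \<ge> 0" "cgf' l = t"
  defines "D \<equiv> \<Sum>i\<in>I. (\<mu> i 2 / \<mu> i 1)\<^sup>2"
  defines "V \<equiv> \<Sum>i\<in>I. (bs i)\<^sup>2 * C p (8 * t * bs i / D) (2 * bs i) (\<mu> i)"
  shows "cgf l - l * t \<le> - (t\<^sup>2 / (2 * V))"
proof -
  have D: "D > 0" unfolding D_def
  proof (rule sum_pos[OF fin I])
    show "0 < (\<mu> i 2 / \<mu> i 1)\<^sup>2" if "i \<in> I" for i
      using centered_bounded.\<mu>_pos[OF summand[OF that]] by (metis zero_less_divide_iff zero_less_power)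
  qed
  have y: "8 * t * bs i / D \<ge> 0" if "i \<in> I" for i using D t bs(1)[OF that] by simp
  have "D \<le> 4 * V" unfolding D_def V_def sum_distrib_left
    by (intro sum_mono) (use centered_bounded.C_ge[OF summand p y] D_def in simp)
  then have V: "V > 0" "V \<ge> D / 4" using D by auto
  \<comment> \<open>the minimiser of \<open>u\<^sup>2 * V / 2 - u * t\<close>\<close>
  define u where "u = t / V"
  have u: "u > 0" using V t by (simp add: u_def)
  have "cgf u \<le> u\<^sup>2 * V / 2"
  proof (rule cgf_le_quadratic[OF u])
    fix z assume z: "0 \<le> z" "z \<le> u"
    have "u \<le> t / (D / 4)" unfolding u_def using V D t by (intro divide_left_mono) auto
    with z have z4: "z \<le> 4 * t / D" by (simp add: mult.commute)
    show "cgf'' z \<le> V" unfolding cgf''_def V_def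
    proof (rule sum_mono)
      fix i assume i: "i \<in> I"
      have "2 * bs i * z \<le> 2 * bs i * (4 * t / D)"
        using z4 bs(1)[OF i] by (intro mult_left_mono) auto
      then have le: "2 * bs i * z \<le> 8 * t * bs i / D" by (simp add: mult_ac)
      have "tilted_var z i \<le> (bs i)\<^sup>2 * C p (2 * bs i * z) (2 * bs i) (\<mu> i)"
        by (rule centered_bounded.tilted_var_le_C[OF summand[OF i] z(1) p])
      also have "\<dots> \<le> (bs i)\<^sup>2 * C p (8 * t * bs i / D) (2 * bs i) (\<mu> i)"
        using bs(1)[OF i] z(1) by (intro mult_left_mono centered_bounded.C_mono[OF summand[OF i] p _ le]) auto
      finally show "tilted_var z i \<le> (bs i)\<^sup>2 * C p (8 * t * bs i / D) (2 * bs i) (\<mu> i)" .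
    qed
  qed
  moreover have "cgf l - l * t \<le> cgf u - u * t"
    using u l by (intro legendre_min) auto
  moreover have "u\<^sup>2 * V / 2 - u * t = - (t\<^sup>2 / (2 * V))"
    using V by (simp add: u_def power2_eq_square field_simps)
  ultimately show ?thesis by linarith
qed

text \<open>
  It remains to compare \<open>l * s\<close> with \<open>t / \<sigma>\<close> and \<open>s\<close> with \<open>\<sigma>\<close>. The solution \<open>l\<close> of \<open>cgf' l = t\<close> satisfies
  \<open>l * b \<le> 1\<close>, and then \<open>cgf''\<close> is comparable to \<open>\<sigma>\<^sup>2\<close> on \<open>[0, l]\<close>; this gives \<open>l \<le> 9 * t / \<sigma>\<^sup>2\<close> and
  \<open>l * s \<ge> exp (- 3 * l * b) * t / \<sigma>\<close>. The constant \<open>20000\<close> exceeds \<open>3 ^ 6 * 27 + 204\<close>, where \<open>3 ^ 6\<close>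
  bounds \<open>exp (6 * l * b)\<close> and \<open>204 = 68 * 3\<close> comes from \<open>s \<ge> \<sigma> / 3\<close>.
\<close>
lemma tail_bound:
  assumes \<sigma>: "\<sigma> \<ge> 0" "\<sigma>\<^sup>2 = expectation (\<lambda>\<omega>. (S \<omega>)\<^sup>2)" and p: "p \<ge> 1"
    and t: "t > 0" "t \<le> \<sigma>\<^sup>2 / (20000 * b)"
  defines "D \<equiv> \<Sum>i\<in>I. (\<mu> i 2 / \<mu> i 1)\<^sup>2"
  shows "prob {\<omega>\<in>space M. S \<omega> \<ge> t}
    \<le> exp (- (t\<^sup>2 / (2 * (\<Sum>i\<in>I. (bs i)\<^sup>2 * C p (8 * t * bs i / D) (2 * bs i) (\<mu> i)))))
      * (\<theta> (t / \<sigma>) + 20000 * b / \<sigma>)"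
proof -
  have \<sigma>2: "\<sigma>\<^sup>2 = \<sigma>2" using \<sigma>(2) variance_S by (simp add: \<sigma>2_def)
  have "0 < \<sigma>\<^sup>2 / (20000 * b)" using t by linarith
  then have "\<sigma>\<^sup>2 > 0" using b_pos by (simp only: zero_less_divide_iff) auto
  then have \<sigma>_pos: "\<sigma> > 0" "\<sigma>2 > 0" using \<sigma>(1) \<sigma>2 zero_less_power2[of \<sigma>] by linarith+
  then have I: "I \<noteq> {}" by (auto simp: \<sigma>2_def)
  have e3: "exp 1 \<le> (3::real)" by (rule exp_le)
  have exp_k: "exp (real k) \<le> 3 ^ k" for k
    using power_mono[OF e3, of k] by (simp flip: exp_of_nat_mult)
  \<comment> \<open>intermediate value theorem on \<open>[0, 1 / b]\<close>: at \<open>1 / b\<close> the derivative is at least \<open>exp (- 2) * \<sigma>\<^sup>2 / b\<close>\<close>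
  obtain l where l: "l > 0" "l * b \<le> 1" "cgf' l = t"
  proof -
    obtain z where z: "0 < z" "z < 1 / b" "cgf' (1 / b) = 1 / b * cgf'' z"
      using cgf'_mean_value[of "1 / b"] b_pos by auto
    have "z * b \<le> 1" using z b_pos by (simp add: field_simps)
    then have "exp (- 2) * \<sigma>2 \<le> exp (- (2 * z * b)) * \<sigma>2"
      using \<sigma>_pos by (intro mult_right_mono) auto
    also have "\<dots> \<le> cgf'' z" using z by (intro cgf''_bounds) auto
    finally have "exp (- 2) * \<sigma>2 / b \<le> cgf' (1 / b)" unfolding z(3) using b_pos by (simp add: divide_right_mono)
    moreover have "t \<le> exp (- 2) * \<sigma>2 / b"
    proof -
      have "exp 2 \<le> (20000::real)" using exp_k[of 2] by simp
      then have "(1::real) / 20000 \<le> 1 / exp 2" by (intro divide_left_mono) auto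
      then have "1 / 20000 * (\<sigma>2 / b) \<le> 1 / exp 2 * (\<sigma>2 / b)"
        using \<sigma>_pos b_pos by (intro mult_right_mono) auto
      then show ?thesis using t(2) by (simp add: \<sigma>2 exp_minus field_simps)
    qed
    ultimately have "t \<le> cgf' (1 / b)" by linarith
    then have "\<exists>l\<ge>0. l \<le> 1 / b \<and> cgf' l = t"
      using t b_pos cgf_0 by (intro IVT) (auto intro!: DERIV_isCont[OF cgf_DERIV(2)])
    then obtain l where l: "0 \<le> l" "l \<le> 1 / b" "cgf' l = t" by auto
    then have "l \<noteq> 0" using cgf_0 t by auto
    with l that[of l] b_pos show thesis by (auto simp: field_simps)
  qed
  have pos: "cgf'' l > 0"
    using cgf''_bounds(1)[of l] l \<sigma>_pos by (smt (verit) exp_gt_zero mult_pos_pos)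
  define s where "s = sqrt (cgf'' l)"
  define r where "r = exp (- (3 * (l * b)))"
  obtain z where z: "0 < z" "z < l" "t = l * cgf'' z" using cgf'_mean_value[OF l(1)] l(3) by metis
  have zl: "z * b \<le> l * b" using z b_pos by (intro mult_right_mono) auto
  have s_ge: "exp (- (l * b)) * \<sigma> \<le> s"
  proof -
    have "(exp (- (l * b)) * \<sigma>)\<^sup>2 = exp (- (2 * l * b)) * \<sigma>2"
      by (simp add: power_mult_distrib \<sigma>2 exp_double[symmetric] mult.assoc)
    also have "\<dots> \<le> cgf'' l" using l by (intro cgf''_bounds) auto
    finally show ?thesis unfolding s_def by (rule real_le_rsqrt)
  qed
  have l_upper: "l \<le> 9 * t / \<sigma>2"
  proof -
    have "exp (- 2) * \<sigma>2 \<le> exp (- (2 * z * b)) * \<sigma>2"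
      using \<sigma>_pos zl l by (intro mult_right_mono) auto
    also have "\<dots> \<le> cgf'' z" using z by (intro cgf''_bounds) auto
    finally have "l * (exp (- 2) * \<sigma>2) \<le> t" using z(3) l by (simp add: mult_left_mono)
    then have "l * \<sigma>2 \<le> exp 2 * t" by (simp add: exp_minus field_simps)
    also have "\<dots> \<le> 9 * t" using exp_k[of 2] t by (intro mult_right_mono) auto
    finally show ?thesis using \<sigma>_pos by (simp add: field_simps)
  qed
  have l_lower: "t * exp (- (2 * (l * b))) \<le> l * \<sigma>2"
  proof -
    have "t \<le> l * (exp (2 * z * b) * \<sigma>2)" using z l by (simp add: mult_left_mono cgf''_bounds)
    also have "\<dots> \<le> l * (exp (2 * (l * b)) * \<sigma>2)"
      using zl l \<sigma>_pos by (intro mult_left_mono mult_right_mono) auto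
    finally show ?thesis by (simp add: exp_minus field_simps)
  qed
  have ls: "r * (t / \<sigma>) \<le> l * s"
  proof -
    have "r * (t / \<sigma>) = exp (- (l * b)) * (t * exp (- (2 * (l * b)))) / \<sigma>"
      by (simp add: r_def flip: exp_add)
    also have "\<dots> \<le> exp (- (l * b)) * (l * \<sigma>2) / \<sigma>"
      using l_lower \<sigma>_pos by (intro divide_right_mono mult_left_mono) auto
    also have "\<dots> = l * (exp (- (l * b)) * \<sigma>)"
      using \<sigma>_pos by (simp add: power2_eq_square flip: \<sigma>2)
    also have "\<dots> \<le> l * s" using s_ge l by (intro mult_left_mono) auto
    finally show ?thesis .
  qed
  have r: "0 < r" "r \<le> 1" using l b_pos by (auto simp: r_def)
  have x: "t / \<sigma> > 0" using t \<sigma>_pos by simp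
  have "\<theta> (l * s) \<le> \<theta> (r * (t / \<sigma>))"
    using ls mult_pos_pos[OF r(1) x] by (intro theta_antimono) auto
  also have "\<dots> \<le> \<theta> (t / \<sigma>) + (1 - r) / (r\<^sup>2 * (t / \<sigma>))"
    by (rule theta_scaling[OF x r])
  also have "(1 - r) / (r\<^sup>2 * (t / \<sigma>)) \<le> 19683 * b / \<sigma>"
  proof -
    have "1 + (- (3 * (l * b))) \<le> r" unfolding r_def by (rule exp_ge_add_one_self)
    then have "1 - r \<le> 3 * (l * b)" by simp
    also have "\<dots> \<le> 3 * (9 * t / \<sigma>2 * b)"
      using l_upper b_pos by (intro mult_left_mono mult_right_mono) auto
    finally have 1: "1 - r \<le> 27 * t * b / \<sigma>2" by simp
    have "1 / r\<^sup>2 = exp (6 * (l * b))"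
      by (simp add: r_def exp_minus field_simps flip: exp_double)
    also have "\<dots> \<le> exp (real 6)" using l by simp
    also have "\<dots> \<le> 729" using exp_k[of 6] by simp
    finally have 2: "1 / r\<^sup>2 \<le> 729" .
    have "(1 - r) / (r\<^sup>2 * (t / \<sigma>)) = (1 / r\<^sup>2) * ((1 - r) * (\<sigma> / t))"
      by simp
    also have "\<dots> \<le> 729 * (27 * t * b / \<sigma>2 * (\<sigma> / t))"
      using 1 2 r t \<sigma>_pos by (intro mult_mono mult_right_mono) auto
    also have "\<dots> = 19683 * b / \<sigma>"
      using t \<sigma>_pos by (simp add: power2_eq_square flip: \<sigma>2)
    finally show ?thesis .
  qed
  finally have \<theta>_le: "\<theta> (l * s) \<le> \<theta> (t / \<sigma>) + 19683 * b / \<sigma>" by simp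
  have s_le: "68 * b / s \<le> 204 * b / \<sigma>"
  proof -
    have "1 / 3 \<le> exp (- 1 :: real)" using e3 by (simp add: exp_minus field_simps)
    also have "\<dots> \<le> exp (- (l * b))" using l by simp
    finally have "1 / 3 * \<sigma> \<le> s" using s_ge \<sigma>_pos by (meson mult_right_mono less_imp_le order_trans)
    then have "68 * b / s \<le> 68 * b / (1 / 3 * \<sigma>)"
      using \<sigma>_pos b_pos by (intro divide_left_mono) auto
    then show ?thesis by simp
  qed
  have "prob {\<omega>\<in>space M. S \<omega> \<ge> t} \<le> exp (cgf l - l * t) * (\<theta> (l * s) + 68 * b / s)"
    unfolding s_def by (rule tilt_bound[OF l(1,3) pos])
  also have "\<dots> \<le> exp (- (t\<^sup>2 / (2 * (\<Sum>i\<in>I. (bs i)\<^sup>2 * C p (8 * t * bs i / D) (2 * bs i) (\<mu> i)))))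
      * (\<theta> (t / \<sigma>) + 20000 * b / \<sigma>)"
  proof (rule mult_mono)
    show "exp (cgf l - l * t) \<le> exp (- (t\<^sup>2 / (2 * (\<Sum>i\<in>I. (bs i)\<^sup>2 * C p (8 * t * bs i / D) (2 * bs i) (\<mu> i)))))"
      using exponent_bound[OF I t(1) p less_imp_le[OF l(1)] l(3)] by (simp add: D_def)
    have "19683 * b / \<sigma> + 204 * b / \<sigma> \<le> 20000 * b / \<sigma>"
      using b_pos \<sigma>_pos by (simp add: field_simps)
    then show "\<theta> (l * s) + 68 * b / s \<le> \<theta> (t / \<sigma>) + 20000 * b / \<sigma>"
      using \<theta>_le s_le by linarith
    have "s > 0" using pos by (simp add: s_def)
    then show "0 \<le> \<theta> (l * s) + 68 * b / s" using theta_nonneg[of "l * s"] b_pos by simp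
  qed simp
  finally show ?thesis .
qed

end

section \<open>Almost sure bounds and change of sample space\<close>

text \<open>
  Clipping \<open>X i\<close> to \<open>[- bs i, bs i]\<close> changes it on a null set only and turns the almost sure bound into a sure one.
\<close>
lemma tail_bound_const_20000: "tail_bound_const TYPE('a) 20000"
  unfolding tail_bound_const_def Let_def
proof (intro allI impI)
  fix M :: "'a measure" and n :: nat and X :: "nat \<Rightarrow> 'a \<Rightarrow> real" and b :: real and bs :: "nat \<Rightarrow> real"
    and \<sigma> :: real and p :: nat and t :: real
  assume M: "prob_space M" and b: "b > 0" and bs: "\<forall>i\<in>{1..n}. 0 < bs i \<and> bs i \<le> b"
    and indep: "prob_space.indep_vars M (\<lambda>_. borel) X {1..n}"
    and mean: "\<forall>i\<in>{1..n}. prob_space.expectation M (X i) = 0"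
    and X_le: "\<forall>i\<in>{1..n}. AE \<omega> in M. \<bar>X i \<omega>\<bar> \<le> bs i"
    and \<sigma>: "\<sigma> \<ge> 0" "\<sigma>\<^sup>2 = prob_space.expectation M (\<lambda>\<omega>. (\<Sum>i=1..n. X i \<omega>)\<^sup>2)"
    and p: "p \<ge> 1" and t: "0 < t" "t \<le> \<sigma>\<^sup>2 / (20000 * b)"
  interpret prob_space M by (rule M)
  have X_meas[measurable]: "X i \<in> borel_measurable M" if "i \<in> {1..n}" for i
    using indep that by (auto simp: indep_vars_def)
  define Y where "Y = (\<lambda>i \<omega>. max (- bs i) (min (bs i) (X i \<omega>)))"
  have Y_meas[measurable]: "Y i \<in> borel_measurable M" if "i \<in> {1..n}" for i
    unfolding Y_def using X_meas[OF that] by measurable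
  have XY: "AE \<omega> in M. Y i \<omega> = X i \<omega>" if "i \<in> {1..n}" for i
    using X_le[rule_format, OF that] by eventually_elim (auto simp: Y_def abs_le_iff)
  have XY_all: "AE \<omega> in M. \<forall>i\<in>{1..n}. Y i \<omega> = X i \<omega>"
    using XY by (intro AE_finite_allI) auto
  then have XY_sum: "AE \<omega> in M. (\<Sum>i=1..n. Y i \<omega>) = (\<Sum>i=1..n. X i \<omega>)"
    by eventually_elim (rule sum.cong, auto)
  interpret Y: bounded_independent_family M "{1..n}" Y bs b
  proof unfold_locales
    show "indep_vars (\<lambda>_. borel) Y {1..n}"
      unfolding Y_def by (rule indep_vars_compose2[OF indep]) measurable
    show "expectation (Y i) = 0" if "i \<in> {1..n}" for i
      using mean that integral_cong_AE[OF Y_meas[OF that] X_meas[OF that] XY[OF that]] by simp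
    show "\<bar>Y i \<omega>\<bar> \<le> bs i" if "i \<in> {1..n}" for i \<omega>
      using bs that by (force simp: Y_def)
  qed (use bs b in auto)
  have \<mu>: "Y.\<mu> i = (\<lambda>k. expectation (\<lambda>\<omega>. (X i \<omega> + bs i) ^ k))" if "i \<in> {1..n}" for i
  proof
    fix k
    have "expectation (\<lambda>\<omega>. (Y i \<omega> + bs i) ^ k) = expectation (\<lambda>\<omega>. (X i \<omega> + bs i) ^ k)"
      using X_meas[OF that] Y_meas[OF that] XY[OF that]
      by (intro integral_cong_AE) (auto elim!: eventually_mono)
    then show "Y.\<mu> i k = expectation (\<lambda>\<omega>. (X i \<omega> + bs i) ^ k)"
      by (simp add: centered_bounded.\<mu>_def[OF Y.summand[OF that]])
  qed
  have \<sigma>': "\<sigma>\<^sup>2 = expectation (\<lambda>\<omega>. (Y.S \<omega>)\<^sup>2)"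
    unfolding \<sigma>(2) Y.S_def using XY_sum
    by (intro integral_cong_AE) (auto elim!: eventually_mono)
  have D: "(\<Sum>i\<in>{1..n}. (Y.\<mu> i 2 / Y.\<mu> i 1)\<^sup>2) = (\<Sum>i\<in>{1..n}. (expectation (\<lambda>\<omega>. (X i \<omega> + bs i) ^ 2) / expectation (\<lambda>\<omega>. (X i \<omega> + bs i) ^ 1))\<^sup>2)"
    by (intro sum.cong refl) (simp add: \<mu>)
  have prob: "prob {\<omega>\<in>space M. Y.S \<omega> \<ge> t} = prob {\<omega>\<in>space M. (\<Sum>i=1..n. X i \<omega>) \<ge> t}"
    unfolding Y.S_def using XY_sum
    by (intro measure_eq_AE) (auto elim!: eventually_mono)
  have V: "(\<Sum>i\<in>{1..n}. (bs i)\<^sup>2 * C p (8 * t * bs i / D) (2 * bs i) (Y.\<mu> i))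
     = (\<Sum>i\<in>{1..n}. (bs i)\<^sup>2 * C p (8 * t * bs i / D) (2 * bs i) (\<lambda>k. expectation (\<lambda>\<omega>. (X i \<omega> + bs i) ^ k)))" for D
    by (intro sum.cong refl) (simp add: \<mu>)
  show "prob {\<omega>\<in>space M. (\<Sum>i=1..n. X i \<omega>) \<ge> t}
    \<le> exp (- (t\<^sup>2 / (2 * (\<Sum>i=1..n. (bs i)\<^sup>2 * C p (8 * t * bs i /
          (\<Sum>j=1..n. (expectation (\<lambda>\<omega>. (X j \<omega> + bs j) ^ 2) / expectation (\<lambda>\<omega>. (X j \<omega> + bs j) ^ 1))\<^sup>2))
          (2 * bs i) (\<lambda>k. expectation (\<lambda>\<omega>. (X i \<omega> + bs i) ^ k))))))
      * (\<theta> (t / \<sigma>) + 20000 * b / \<sigma>)"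
    using Y.tail_bound[OF \<sigma>(1) \<sigma>' p t] unfolding prob D V .
qed

text \<open>
  Every quantity in the bound depends only on the joint law of \<open>X 1, \<dots>, X n\<close>, so the variables may be replaced by the
  coordinates on \<open>nat \<Rightarrow> real\<close> under that law.
\<close>
lemma tail_bound_const_transfer:
  assumes K: "tail_bound_const TYPE(nat \<Rightarrow> real) K"
  shows "tail_bound_const TYPE('a) K"
  unfolding tail_bound_const_def Let_def
proof (intro allI impI)
  fix M :: "'a measure" and n :: nat and X :: "nat \<Rightarrow> 'a \<Rightarrow> real" and b :: real and bs :: "nat \<Rightarrow> real"
    and \<sigma> :: real and p :: nat and t :: real
  assume M: "prob_space M" and b: "b > 0" and bs: "\<forall>i\<in>{1..n}. 0 < bs i \<and> bs i \<le> b"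
    and indep: "prob_space.indep_vars M (\<lambda>_. borel) X {1..n}"
    and mean: "\<forall>i\<in>{1..n}. prob_space.expectation M (X i) = 0"
    and X_le: "\<forall>i\<in>{1..n}. AE \<omega> in M. \<bar>X i \<omega>\<bar> \<le> bs i"
    and \<sigma>: "\<sigma> \<ge> 0" "\<sigma>\<^sup>2 = prob_space.expectation M (\<lambda>\<omega>. (\<Sum>i=1..n. X i \<omega>)\<^sup>2)"
    and p: "p \<ge> 1" and t: "0 < t" "t \<le> \<sigma>\<^sup>2 / (K * b)"
  interpret prob_space M by (rule M)
  have X_meas[measurable]: "X i \<in> borel_measurable M" if "i \<in> {1..n}" for i
    using indep that by (auto simp: indep_vars_def)
  define P where "P = PiM {1..n} (\<lambda>_. borel :: real measure)"
  define F where "F = (\<lambda>\<omega>. \<lambda>i\<in>{1..n}. X i \<omega>)"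
  have F[measurable]: "F \<in> measurable M P" unfolding F_def P_def by (intro measurable_restrict X_meas)
  define N where "N = distr M P F"
  define Z where "Z = (\<lambda>i (f :: nat \<Rightarrow> real). f i)"
  interpret N: prob_space N unfolding N_def by (rule prob_space_distr[OF F])
  have Z_meas[measurable]: "Z i \<in> borel_measurable P" if "i \<in> {1..n}" for i
    unfolding Z_def P_def using that by measurable
  have ZF: "Z i (F \<omega>) = X i \<omega>" if "i \<in> {1..n}" for i \<omega> using that by (simp add: Z_def F_def)
  have EN: "N.expectation g = expectation (\<lambda>\<omega>. g (F \<omega>))" if "g \<in> borel_measurable P" for g :: "_ \<Rightarrow> real"
    unfolding N_def by (rule integral_distr[OF F that])
  have ZF_sum: "(\<Sum>i=1..n. Z i (F \<omega>)) = (\<Sum>i=1..n. X i \<omega>)" for \<omega>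
    by (intro sum.cong) (auto simp: ZF)
  have indepN: "N.indep_vars (\<lambda>_. borel) Z {1..n}"
  proof (cases "n = 0")
    case True
    then show ?thesis by (simp add: N.indep_vars_def N.indep_sets_def)
  next
    case False
    have "N.indep_vars (\<lambda>_. borel) Z {1..n} \<longleftrightarrow>
        distr N (PiM {1..n} (\<lambda>_. borel)) (\<lambda>x. \<lambda>i\<in>{1..n}. Z i x) = PiM {1..n} (\<lambda>i. distr N borel (Z i))"
      using False by (intro N.indep_vars_iff_distr_eq_PiM') (auto simp: N_def)
    also have "distr N (PiM {1..n} (\<lambda>_. borel)) (\<lambda>x. \<lambda>i\<in>{1..n}. Z i x) = distr M P (\<lambda>\<omega>. \<lambda>i\<in>{1..n}. X i \<omega>)"
      unfolding N_def
      by (subst distr_distr) (auto simp: P_def comp_def ZF Z_def F_def cong: restrict_cong intro!: measurable_restrict)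
    also have "PiM {1..n} (\<lambda>i. distr N borel (Z i)) = PiM {1..n} (\<lambda>i. distr M borel (X i))"
    proof (rule PiM_cong[OF refl])
      fix i assume i: "i \<in> {1..n}"
      show "distr N borel (Z i) = distr M borel (X i)"
        unfolding N_def by (subst distr_distr) (auto simp: comp_def ZF[OF i] Z_meas[OF i])
    qed
    also have "distr M P (\<lambda>\<omega>. \<lambda>i\<in>{1..n}. X i \<omega>) = PiM {1..n} (\<lambda>i. distr M borel (X i)) \<longleftrightarrow> indep_vars (\<lambda>_. borel) X {1..n}"
      unfolding P_def using False by (intro indep_vars_iff_distr_eq_PiM'[symmetric]) (auto simp: X_meas)
    finally show ?thesis using indep by simp
  qed
  have meanN: "\<forall>i\<in>{1..n}. N.expectation (Z i) = 0"
    using mean by (auto simp: EN ZF)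
  have Z_le: "\<forall>i\<in>{1..n}. AE x in N. \<bar>Z i x\<bar> \<le> bs i"
  proof
    fix i assume i: "i \<in> {1..n}"
    note [measurable] = Z_meas[OF i]
    show "AE x in N. \<bar>Z i x\<bar> \<le> bs i"
      unfolding N_def using X_le i by (subst AE_distr_iff) (auto simp: ZF)
  qed
  have sum_meas[measurable]: "(\<lambda>x. \<Sum>i=1..n. Z i x) \<in> borel_measurable P"
    by (intro borel_measurable_sum Z_meas)
  have \<sigma>N: "\<sigma>\<^sup>2 = N.expectation (\<lambda>x. (\<Sum>i=1..n. Z i x)\<^sup>2)"
    unfolding \<sigma>(2) by (subst EN) (auto simp: ZF_sum simp del: One_nat_def)
  have \<mu>N: "N.expectation (\<lambda>x. (Z i x + bs i) ^ k) = expectation (\<lambda>\<omega>. (X i \<omega> + bs i) ^ k)" if i: "i \<in> {1..n}" for i k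
  proof -
    note [measurable] = Z_meas[OF i]
    show ?thesis by (subst EN) (auto simp: ZF[OF i])
  qed
  have DN: "(\<Sum>j=1..n. (N.expectation (\<lambda>x. (Z j x + bs j) ^ 2) / N.expectation (\<lambda>x. (Z j x + bs j) ^ 1))\<^sup>2)
    = (\<Sum>j=1..n. (expectation (\<lambda>\<omega>. (X j \<omega> + bs j) ^ 2) / expectation (\<lambda>\<omega>. (X j \<omega> + bs j) ^ 1))\<^sup>2)"
    by (intro sum.cong refl arg_cong2[where f=power] arg_cong2[where f="(/)"] \<mu>N)
  have VN: "(\<Sum>i=1..n. (bs i)\<^sup>2 * C p (8 * t * bs i / D) (2 * bs i) (\<lambda>k. N.expectation (\<lambda>x. (Z i x + bs i) ^ k)))
    = (\<Sum>i=1..n. (bs i)\<^sup>2 * C p (8 * t * bs i / D) (2 * bs i) (\<lambda>k. expectation (\<lambda>\<omega>. (X i \<omega> + bs i) ^ k)))" for D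
    by (intro sum.cong refl) (simp add: \<mu>N)
  have probN: "N.prob {x\<in>space N. (\<Sum>i=1..n. Z i x) \<ge> t} = prob {\<omega>\<in>space M. (\<Sum>i=1..n. X i \<omega>) \<ge> t}"
  proof -
    have "N.prob {x\<in>space N. (\<Sum>i=1..n. Z i x) \<ge> t} = prob (F -` {x\<in>space P. (\<Sum>i=1..n. Z i x) \<ge> t} \<inter> space M)"
      unfolding N_def by (subst measure_distr) auto
    also have "F -` {x\<in>space P. (\<Sum>i=1..n. Z i x) \<ge> t} \<inter> space M = {\<omega>\<in>space M. (\<Sum>i=1..n. X i \<omega>) \<ge> t}"
      using measurable_space[OF F] by (auto simp: ZF_sum simp del: One_nat_def)
    finally show ?thesis .
  qed
  note main = K[unfolded tail_bound_const_def Let_def, rule_format, of N b n bs Z \<sigma> p t]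
  show "prob {\<omega>\<in>space M. (\<Sum>i=1..n. X i \<omega>) \<ge> t}
    \<le> exp (- (t\<^sup>2 / (2 * (\<Sum>i=1..n. (bs i)\<^sup>2 * C p (8 * t * bs i /
          (\<Sum>j=1..n. (expectation (\<lambda>\<omega>. (X j \<omega> + bs j) ^ 2) / expectation (\<lambda>\<omega>. (X j \<omega> + bs j) ^ 1))\<^sup>2))
          (2 * bs i) (\<lambda>k. expectation (\<lambda>\<omega>. (X i \<omega> + bs i) ^ k))))))
      * (\<theta> (t / \<sigma>) + K * b / \<sigma>)"
    using main[OF N.prob_space_axioms b _ indepN _ _ \<sigma>(1) \<sigma>N p t] bs meanN Z_le
    unfolding probN DN VN by blast
qed

theorem corollary2:
  "(\<exists>K>0. tail_bound_const TYPE(nat \<Rightarrow> real) K) \<and>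
   (\<forall>K>0. tail_bound_const TYPE(nat \<Rightarrow> real) K \<longrightarrow> tail_bound_const TYPE('a) K)"
  using tail_bound_const_20000 tail_bound_const_transfer
  by (metis zero_less_numeral)

end
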